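(* Let $K$ be a discrete field, $I$ a finitely generated ideal of the ring $K[X_1,\ldots,X_\ell]$ and $A=K[X_1,\ldots,X_\ell]/I$ the quotient algebra. Let $r$ be an integer and $y_1,\ldots,y_r$ elements of $A$ as given by Noether's normalisation lemma applied to the ideal $I$, that is, $y_1,\ldots,y_r$ are algebraically independent over $K$ and $A$ is a finitely generated module over $K[y_1,\ldots,y_r]$. Then the Krull dimension of $A$ is equal to $r$.
   Context: A discrete field is a field with decidable equality. Krull dimension of a commutative ring $A$: $A$ is of dimension $-1$ iff $1=0$ in $A$, and of dimension $\ge0$ iff $1\neq0$ in $A$. For $m\ge1$, $A$ is of dimension $\le m-1$ iff for all $x_1,\ldots,x_m\in A$ there exist $a_1,\ldots,a_m\in A$ and $m_1,\ldots,m_m\in\mathbb{N}$ with $$x_1^{m_1}(x_2^{m_2}\cdots(x_m^{m_m}(1+a_mx_m)+\cdots+a_2x_2)+a_1x_1)=0;$$ $A$ is of dimension $\ge m$ iff there is a sequence $x_1,\ldots,x_m$ in $A$ such that the left-hand side is $\ne0$ for all $a_i\in A$ and all $m_i\in\mathbb{N}$. $A$ is of dimension $m$ iff it is both of dimension $\le m$ and of dimension $\ge m$. *)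

theory Defs
  imports
    "HOL-Algebra.QuotRing"
    "HOL-Algebra.Generated_Rings"
    "HOL-Algebra.Embedded_Algebras"
    "HOL-Library.Poly_Mapping"
begin

section \<open>The ring of polynomials in finitely many variables over a field\<close>

text \<open>A monomial is a finitely supported exponent function, and a polynomial is a finitely
  supported coefficient function on monomials; the multiplication of \<^type>\<open>poly_mapping\<close> is the
  convolution product. The variables of \<open>mpoly_ring l\<close> are those with indices
  \<open>0, \<dots>, l - 1\<close>.\<close>

type_synonym 'a mpoly = "(nat \<Rightarrow>\<^sub>0 nat) \<Rightarrow>\<^sub>0 'a"

definition mpoly_ring :: "nat \<Rightarrow> ('a::field mpoly) ring" where
  "mpoly_ring l =
     \<lparr> carrier = {p. \<forall>m \<in> Poly_Mapping.keys p. Poly_Mapping.keys m \<subseteq> {..<l}},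
       monoid.mult = (*), one = 1, zero = 0, add = (+) \<rparr>"

definition mpoly_const :: "'a::field \<Rightarrow> 'a mpoly" where
  "mpoly_const c = Poly_Mapping.single 0 c"


section \<open>Algebras over a field\<close>

text \<open>In this section a commutative ring \<open>A\<close> is regarded as a \<open>K\<close>-algebra through its
  structural map \<open>\<phi>\<close> from \<open>K\<close> to \<open>A\<close>.\<close>

definition mpoly_eval ::
    "('b, 'c) ring_scheme \<Rightarrow> ('a::field \<Rightarrow> 'b) \<Rightarrow> (nat \<Rightarrow> 'b) \<Rightarrow> 'a mpoly \<Rightarrow> 'b" where
  "mpoly_eval A \<phi> y p =
     (\<Oplus>\<^bsub>A\<^esub>m \<in> Poly_Mapping.keys p.
        \<phi> (Poly_Mapping.lookup p m) \<otimes>\<^bsub>A\<^esub>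
        (\<Otimes>\<^bsub>A\<^esub>i \<in> Poly_Mapping.keys m. y i [^]\<^bsub>A\<^esub> Poly_Mapping.lookup m i))"

definition algebraically_independent ::
    "('b, 'c) ring_scheme \<Rightarrow> ('a::field \<Rightarrow> 'b) \<Rightarrow> nat \<Rightarrow> (nat \<Rightarrow> 'b) \<Rightarrow> bool" where
  "algebraically_independent A \<phi> r y \<longleftrightarrow>
     (\<forall>p \<in> carrier (mpoly_ring r). mpoly_eval A \<phi> y p = \<zero>\<^bsub>A\<^esub> \<longrightarrow> p = 0)"

definition generated_subalgebra ::
    "('b, 'c) ring_scheme \<Rightarrow> ('a::field \<Rightarrow> 'b) \<Rightarrow> nat \<Rightarrow> (nat \<Rightarrow> 'b) \<Rightarrow> 'b set" where
  "generated_subalgebra A \<phi> r y = generate_ring A (range \<phi> \<union> y ` {..<r})"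

text \<open>\<^const>\<open>ring.Span\<close> makes sense for an arbitrary subring of scalars, not only for a
  subfield: it is the set of linear combinations of the listed elements.\<close>

definition finitely_generated_over :: "('b, 'c) ring_scheme \<Rightarrow> 'b set \<Rightarrow> bool" where
  "finitely_generated_over A S \<longleftrightarrow>
     (\<exists>bs. set bs \<subseteq> carrier A \<and> ring.Span A S bs = carrier A)"


section \<open>Krull dimension, elementary definition\<close>

text \<open>The sequences \<open>x\<^sub>1, \<dots>, x\<^sub>m\<close>, \<open>a\<^sub>1, \<dots>, a\<^sub>m\<close> and the exponents are indexed from \<open>0\<close> to
  \<open>m - 1\<close>. The fold is from the right, so that index \<open>0\<close> is the outermost one; for \<open>m = 0\<close> the
  expression is \<open>1\<close>.\<close>

definition krull_expr ::
    "('b, 'c) ring_scheme \<Rightarrow> nat \<Rightarrow> (nat \<Rightarrow> 'b) \<Rightarrow> (nat \<Rightarrow> 'b) \<Rightarrow> (nat \<Rightarrow> nat) \<Rightarrow> 'b" where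
  "krull_expr A m x a e =
     foldr (\<lambda>i u. (x i [^]\<^bsub>A\<^esub> e i) \<otimes>\<^bsub>A\<^esub> (u \<oplus>\<^bsub>A\<^esub> a i \<otimes>\<^bsub>A\<^esub> x i)) [0..<m] \<one>\<^bsub>A\<^esub>"

text \<open>Dimensions are integers at least \<open>-1\<close>. As the empty expression is \<open>1\<close>, the
  instance \<open>d = -1\<close> of the first definition says \<open>1 = 0\<close>, and the instance \<open>d = 0\<close> of the
  second one says that \<open>1\<close> is different from \<open>0\<close>.\<close>

definition krull_dim_le :: "('b, 'c) ring_scheme \<Rightarrow> int \<Rightarrow> bool" where
  "krull_dim_le A d \<longleftrightarrow> d \<ge> -1 \<and>
     (\<forall>x. (\<forall>i < nat (d + 1). x i \<in> carrier A) \<longrightarrow>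
        (\<exists>a e. (\<forall>i < nat (d + 1). a i \<in> carrier A) \<and>
               krull_expr A (nat (d + 1)) x a e = \<zero>\<^bsub>A\<^esub>))"

definition krull_dim_ge :: "('b, 'c) ring_scheme \<Rightarrow> int \<Rightarrow> bool" where
  "krull_dim_ge A d \<longleftrightarrow> d \<le> -1 \<or>
     (\<exists>x. (\<forall>i < nat d. x i \<in> carrier A) \<and>
        (\<forall>a e. (\<forall>i < nat d. a i \<in> carrier A) \<longrightarrow>
               krull_expr A (nat d) x a e \<noteq> \<zero>\<^bsub>A\<^esub>))"

definition has_krull_dim :: "('b, 'c) ring_scheme \<Rightarrow> int \<Rightarrow> bool" where
  "has_krull_dim A d \<longleftrightarrow> krull_dim_le A d \<and> krull_dim_ge A d"

end

theory Submission
  imports Defs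
begin

text \<open>
  Upper bound: by counting dimensions, \<open>r + 1\<close> elements of \<open>A\<close> satisfy a nonzero polynomial relation
  over \<open>K\<close>. Singling out its lexicographically smallest monomial puts the relation into the nested
  form required by the definition of Krull dimension.

  Lower bound: the sequence \<open>y\<^sub>1, \<dots>, y\<^sub>r\<close> itself admits no nested relation. From such a relation one
  builds ideals \<open>J\<^sub>0 \<subseteq> \<dots> \<subseteq> J\<^sub>r\<close> of \<open>A\<close>, where \<open>J\<^sub>k\<^sub>+\<^sub>1\<close> arises from \<open>J\<^sub>k\<close> by saturating at
  \<open>y\<^sub>k\<^sub>+\<^sub>1\<close> and then adding \<open>y\<^sub>k\<^sub>+\<^sub>1\<close>, such that the \<open>k\<close>-th inner subexpression lies in \<open>J\<^sub>k\<close>.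
  Finiteness over the polynomial ring keeps the contraction of \<open>J\<^sub>k\<close> inside the prime ideal
  \<open>(y\<^sub>1, \<dots>, y\<^sub>k)\<close>; for \<open>k = r\<close> the innermost expression \<open>1\<close> would lie in a proper ideal.
\<close>

section \<open>Homomorphisms and ideals in type class rings\<close>

locale comm_ring_hom =
  fixes h :: "'a::comm_ring_1 \<Rightarrow> 'b::comm_ring_1"
  assumes add: "h (x + y) = h x + h y"
    and mult: "h (x * y) = h x * h y"
    and one: "h 1 = 1"
begin

lemma zero: "h 0 = 0"
  using add[of 0 0] by simp

lemma uminus: "h (- x) = - h x"
  using add[of x "- x"] zero by (simp add: eq_neg_iff_add_eq_0 add.commute)

lemma diff: "h (x - y) = h x - h y"
  using add[of x "- y"] by (simp add: uminus)

lemma power: "h (x ^ n) = h x ^ n"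
  by (induction n) (simp_all add: one mult)

lemma sum: "h (sum f S) = (\<Sum>i\<in>S. h (f i))"
  by (induction S rule: infinite_finite_induct) (simp_all add: zero add)

lemma prod: "h (prod f S) = (\<Prod>i\<in>S. h (f i))"
  by (induction S rule: infinite_finite_induct) (simp_all add: one mult)

lemmas simps = add mult one zero uminus diff power sum prod

end

locale ring_ideal =
  fixes J :: "'a::comm_ring_1 set"
  assumes zero: "0 \<in> J"
    and add: "x \<in> J \<Longrightarrow> y \<in> J \<Longrightarrow> x + y \<in> J"
    and mult: "x \<in> J \<Longrightarrow> r * x \<in> J"
begin

lemma mult_right: "x \<in> J \<Longrightarrow> x * r \<in> J"
  using mult[of x r] by (simp add: mult.commute)

lemma uminus: "x \<in> J \<Longrightarrow> - x \<in> J"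
  using mult[of x "- 1"] by simp

lemma sum: "(\<And>i. i \<in> S \<Longrightarrow> f i \<in> J) \<Longrightarrow> sum f S \<in> J"
  by (induction S rule: infinite_finite_induct) (simp_all add: zero add)

end


section \<open>Evaluation of polynomials\<close>

definition monom_eval :: "(nat \<Rightarrow> 'b::comm_ring_1) \<Rightarrow> (nat \<Rightarrow>\<^sub>0 nat) \<Rightarrow> 'b" where
  "monom_eval y m = (\<Prod>i\<in>Poly_Mapping.keys m. y i ^ Poly_Mapping.lookup m i)"

text \<open>The counterpart of \<open>mpoly_eval\<close> for a ring that is a whole type;
  \<open>mpoly_eval_eq\<close> carries it over to \<open>A\<close> along a surjection.\<close>

definition poly_eval :: "('a::field \<Rightarrow> 'b::comm_ring_1) \<Rightarrow> (nat \<Rightarrow> 'b) \<Rightarrow> 'a mpoly \<Rightarrow> 'b" where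
  "poly_eval \<kappa> y p = (\<Sum>m\<in>Poly_Mapping.keys p. \<kappa> (Poly_Mapping.lookup p m) * monom_eval y m)"

definition mpoly_var :: "nat \<Rightarrow> 'a::field mpoly" where
  "mpoly_var i = Poly_Mapping.single (Poly_Mapping.single i 1) 1"

lemma monom_eval_superset:
  assumes "finite S" "Poly_Mapping.keys m \<subseteq> S"
  shows "monom_eval y m = (\<Prod>i\<in>S. y i ^ Poly_Mapping.lookup m i)"
  unfolding monom_eval_def
  by (rule prod.mono_neutral_left) (use assms in \<open>auto simp: in_keys_iff\<close>)

lemma monom_eval_zero [simp]: "monom_eval y 0 = 1"
  by (simp add: monom_eval_def)

lemma monom_eval_single [simp]: "monom_eval y (Poly_Mapping.single i n) = y i ^ n"
  by (subst monom_eval_superset[of "{i}"]) auto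

lemma monom_eval_add: "monom_eval y (m + n) = monom_eval y m * monom_eval y n"
proof -
  let ?S = "Poly_Mapping.keys m \<union> Poly_Mapping.keys n"
  have "monom_eval y (m + n) = (\<Prod>i\<in>?S. y i ^ Poly_Mapping.lookup (m + n) i)"
    by (rule monom_eval_superset) (use Poly_Mapping.keys_add[of m n] in auto)
  also have "\<dots> = (\<Prod>i\<in>?S. y i ^ Poly_Mapping.lookup m i) * (\<Prod>i\<in>?S. y i ^ Poly_Mapping.lookup n i)"
    by (simp add: lookup_add power_add prod.distrib)
  also have "\<dots> = monom_eval y m * monom_eval y n"
    by (subst (1 2) monom_eval_superset[of ?S]) auto
  finally show ?thesis .
qed

lemma poly_mapping_sum_single:
  fixes p :: "'k \<Rightarrow>\<^sub>0 'v::comm_monoid_add"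
  shows "(\<Sum>m\<in>Poly_Mapping.keys p. Poly_Mapping.single m (Poly_Mapping.lookup p m)) = p"
proof (rule poly_mapping_eqI)
  fix k
  have "(\<Sum>m\<in>Poly_Mapping.keys p. Poly_Mapping.lookup (Poly_Mapping.single m (Poly_Mapping.lookup p m)) k)
      = (\<Sum>m\<in>Poly_Mapping.keys p. if m = k then Poly_Mapping.lookup p m else 0)"
    by (intro sum.cong) (auto simp: lookup_single when_def)
  then show "Poly_Mapping.lookup (\<Sum>m\<in>Poly_Mapping.keys p. Poly_Mapping.single m (Poly_Mapping.lookup p m)) k
      = Poly_Mapping.lookup p k"
    by (simp add: lookup_sum in_keys_iff)
qed

lemma mpoly_single_eq:
  "Poly_Mapping.single m c = mpoly_const c * monom_eval mpoly_var m"
proof -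
  have pow: "(mpoly_var i :: 'a mpoly) ^ n = Poly_Mapping.single (Poly_Mapping.single i n) 1" for i n
    by (induction n) (simp_all add: mpoly_var_def mult_single flip: single_add)
  have "monom_eval (mpoly_var :: nat \<Rightarrow> 'a mpoly) m = Poly_Mapping.single m 1"
  proof -
    have "(\<Prod>i\<in>S. (mpoly_var i :: 'a mpoly) ^ Poly_Mapping.lookup m i)
        = Poly_Mapping.single (\<Sum>i\<in>S. Poly_Mapping.single i (Poly_Mapping.lookup m i)) 1" for S
      by (induction S rule: infinite_finite_induct) (simp_all add: pow mult_single)
    then show ?thesis
      by (simp add: monom_eval_def poly_mapping_sum_single)
  qed
  then show ?thesis
    by (simp add: mpoly_const_def mult_single)
qed

lemma mpoly_const_hom: "comm_ring_hom mpoly_const"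
  by unfold_locales (simp_all add: mpoly_const_def single_add mult_single)

text \<open>With the sum of the terms of \<open>p\<close> read as an evaluation, a substitution that
  fixes the variables occurring in \<open>p\<close> can be recognised as the identity on
  \<open>p\<close>.\<close>

lemma mpoly_eq_poly_eval: "poly_eval mpoly_const mpoly_var p = p"
  using poly_mapping_sum_single[of p] by (simp add: poly_eval_def mpoly_single_eq)

lemma (in comm_ring_hom) poly_eval:
  "h (poly_eval \<kappa> y p) = poly_eval (\<lambda>c. h (\<kappa> c)) (\<lambda>i. h (y i)) p"
  by (simp add: poly_eval_def monom_eval_def simps)

lemma poly_eval_cong:
  assumes "\<And>m i. m \<in> Poly_Mapping.keys p \<Longrightarrow> i \<in> Poly_Mapping.keys m \<Longrightarrow> y i = z i"
  shows "poly_eval \<kappa> y p = poly_eval \<kappa> z p"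
  unfolding poly_eval_def monom_eval_def using assms by (auto intro!: sum.cong prod.cong)

context
  fixes \<kappa> :: "'a::field \<Rightarrow> 'b::comm_ring_1" and y :: "nat \<Rightarrow> 'b"
  assumes \<kappa>: "comm_ring_hom \<kappa>"
begin

interpretation \<kappa>: comm_ring_hom \<kappa> by (fact \<kappa>)

lemma poly_eval_superset:
  assumes "finite S" "Poly_Mapping.keys p \<subseteq> S"
  shows "poly_eval \<kappa> y p = (\<Sum>m\<in>S. \<kappa> (Poly_Mapping.lookup p m) * monom_eval y m)"
  unfolding poly_eval_def
  by (rule sum.mono_neutral_left) (use assms in \<open>auto simp: in_keys_iff \<kappa>.zero\<close>)

lemma poly_eval_single: "poly_eval \<kappa> y (Poly_Mapping.single m c) = \<kappa> c * monom_eval y m"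
  by (subst poly_eval_superset[of "{m}"]) auto

lemma poly_eval_add: "poly_eval \<kappa> y (p + q) = poly_eval \<kappa> y p + poly_eval \<kappa> y q"
proof -
  let ?S = "Poly_Mapping.keys p \<union> Poly_Mapping.keys q"
  have "poly_eval \<kappa> y (p + q) = (\<Sum>m\<in>?S. \<kappa> (Poly_Mapping.lookup (p + q) m) * monom_eval y m)"
    by (rule poly_eval_superset) (use Poly_Mapping.keys_add[of p q] in auto)
  also have "\<dots> = (\<Sum>m\<in>?S. \<kappa> (Poly_Mapping.lookup p m) * monom_eval y m)
                 + (\<Sum>m\<in>?S. \<kappa> (Poly_Mapping.lookup q m) * monom_eval y m)"
    by (simp add: lookup_add \<kappa>.add distrib_right sum.distrib)
  also have "\<dots> = poly_eval \<kappa> y p + poly_eval \<kappa> y q"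
    by (subst (1 2) poly_eval_superset[of ?S]) auto
  finally show ?thesis .
qed

lemma poly_eval_zero: "poly_eval \<kappa> y 0 = 0"
  by (simp add: poly_eval_def)

lemma poly_eval_sum: "poly_eval \<kappa> y (sum f S) = (\<Sum>i\<in>S. poly_eval \<kappa> y (f i))"
  by (induction S rule: infinite_finite_induct) (simp_all add: poly_eval_add poly_eval_zero)

lemma poly_eval_mult: "poly_eval \<kappa> y (p * q) = poly_eval \<kappa> y p * poly_eval \<kappa> y q"
proof -
  let ?s = "\<lambda>p m. Poly_Mapping.single m (Poly_Mapping.lookup p m)"
  have "poly_eval \<kappa> y (p * q) = poly_eval \<kappa> y
      ((\<Sum>m\<in>Poly_Mapping.keys p. ?s p m) * (\<Sum>n\<in>Poly_Mapping.keys q. ?s q n))"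
    by (simp add: poly_mapping_sum_single)
  also have "\<dots> = (\<Sum>m\<in>Poly_Mapping.keys p. \<Sum>n\<in>Poly_Mapping.keys q.
      \<kappa> (Poly_Mapping.lookup p m * Poly_Mapping.lookup q n) * monom_eval y (m + n))"
    by (simp add: sum_product mult_single poly_eval_sum poly_eval_single)
  also have "\<dots> = poly_eval \<kappa> y p * poly_eval \<kappa> y q"
    by (simp add: poly_eval_def sum_product \<kappa>.mult monom_eval_add mult_ac)
  finally show ?thesis .
qed

lemma poly_eval_hom: "comm_ring_hom (poly_eval \<kappa> y)"
  by unfold_locales
    (simp_all add: poly_eval_add poly_eval_mult poly_eval_single \<kappa>.one flip: single_one)

lemma poly_eval_const: "poly_eval \<kappa> y (mpoly_const c) = \<kappa> c"
  by (simp add: mpoly_const_def poly_eval_single)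

lemma poly_eval_var: "poly_eval \<kappa> y (mpoly_var i) = y i"
  by (simp add: mpoly_var_def poly_eval_single \<kappa>.one)

lemma poly_eval_poly_eval:
  "poly_eval \<kappa> y (poly_eval mpoly_const z p) = poly_eval \<kappa> (\<lambda>i. poly_eval \<kappa> y (z i)) p"
  by (simp add: comm_ring_hom.poly_eval[OF poly_eval_hom] poly_eval_const)

end


text \<open>Setting the variables outside \<open>V\<close> to 0 is a ring endomorphism. For
  \<open>V = {..<l}\<close> it retracts the whole type onto the polynomials in \<open>l\<close>
  variables; for \<open>V = {k..<r}\<close> its kernel encodes a prime ideal, because the target has
  no zero divisors.\<close>

definition restrict_vars :: "nat set \<Rightarrow> 'a::field mpoly \<Rightarrow> 'a mpoly" where
  "restrict_vars V = poly_eval mpoly_const (\<lambda>i. if i \<in> V then mpoly_var i else 0)"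

lemma restrict_vars_hom: "comm_ring_hom (restrict_vars V)"
  unfolding restrict_vars_def by (rule poly_eval_hom[OF mpoly_const_hom])

lemma restrict_vars_const: "restrict_vars V (mpoly_const c) = mpoly_const c"
  by (simp add: restrict_vars_def poly_eval_const mpoly_const_hom)

lemma restrict_vars_var: "restrict_vars V (mpoly_var i) = (if i \<in> V then mpoly_var i else 0)"
  by (simp add: restrict_vars_def poly_eval_var mpoly_const_hom)

text \<open>Vanishing after restriction to \<open>W\<close> is thus inherited by every subset of
  \<open>W\<close>; this is how the kernel for \<open>k\<close> passes into the kernel for
  \<open>k + 1\<close>.\<close>

lemma restrict_vars_restrict_vars: "restrict_vars V (restrict_vars W p) = restrict_vars (V \<inter> W) p"
proof -
  have "restrict_vars V (restrict_vars W p) =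
      poly_eval mpoly_const (\<lambda>i. restrict_vars V (if i \<in> W then mpoly_var i else 0)) p"
    by (simp add: restrict_vars_def[of W] comm_ring_hom.poly_eval[OF restrict_vars_hom] restrict_vars_const)
  also have "(\<lambda>i. restrict_vars V (if i \<in> W then mpoly_var i else 0)) =
      (\<lambda>i. if i \<in> V \<inter> W then mpoly_var i else 0 :: 'a mpoly)"
    by (auto simp: restrict_vars_var comm_ring_hom.zero[OF restrict_vars_hom])
  finally show ?thesis
    by (simp add: restrict_vars_def)
qed

lemma mpoly_var_nonzero: "mpoly_var i \<noteq> 0"
  by (metis lookup_single_eq lookup_zero mpoly_var_def zero_neq_one)

section \<open>Closure properties of the polynomials in \<open>l\<close> variables\<close>

lemma carrier_mpoly_ring_iff:
  "p \<in> carrier (mpoly_ring l) \<longleftrightarrow> (\<forall>m\<in>Poly_Mapping.keys p. Poly_Mapping.keys m \<subseteq> {..<l})"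
  by (simp add: mpoly_ring_def)

lemma mpoly_ring_simps [simp]:
  "x \<otimes>\<^bsub>mpoly_ring l\<^esub> y = x * y" "x \<oplus>\<^bsub>mpoly_ring l\<^esub> y = x + y"
  "\<one>\<^bsub>mpoly_ring l\<^esub> = 1" "\<zero>\<^bsub>mpoly_ring l\<^esub> = 0"
  by (simp_all add: mpoly_ring_def)

lemma mpoly_carrier_zero: "0 \<in> carrier (mpoly_ring l)"
  by (simp add: carrier_mpoly_ring_iff)

lemma mpoly_carrier_one: "1 \<in> carrier (mpoly_ring l)"
  by (simp add: carrier_mpoly_ring_iff)

lemma mpoly_carrier_add:
  "p \<in> carrier (mpoly_ring l) \<Longrightarrow> q \<in> carrier (mpoly_ring l) \<Longrightarrow> p + q \<in> carrier (mpoly_ring l)"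
  using Poly_Mapping.keys_add[of p q] by (fastforce simp: carrier_mpoly_ring_iff)

lemma mpoly_carrier_uminus:
  "p \<in> carrier (mpoly_ring l) \<Longrightarrow> - p \<in> carrier (mpoly_ring l)"
  by (simp add: carrier_mpoly_ring_iff in_keys_iff)

lemma mpoly_carrier_mult:
  assumes "p \<in> carrier (mpoly_ring l)" "q \<in> carrier (mpoly_ring l)"
  shows "p * q \<in> carrier (mpoly_ring l)"
  unfolding carrier_mpoly_ring_iff
proof
  fix m assume "m \<in> Poly_Mapping.keys (p * q)"
  then obtain a b where "a \<in> Poly_Mapping.keys p" "b \<in> Poly_Mapping.keys q" "m = a + b"
    using keys_mult[of p q] by auto
  then show "Poly_Mapping.keys m \<subseteq> {..<l}"
    using assms Poly_Mapping.keys_add[of a b] unfolding carrier_mpoly_ring_iff by blast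
qed

lemma mpoly_carrier_const: "mpoly_const c \<in> carrier (mpoly_ring l)"
  by (simp add: carrier_mpoly_ring_iff mpoly_const_def)

lemma mpoly_carrier_var: "i < l \<Longrightarrow> mpoly_var i \<in> carrier (mpoly_ring l)"
  by (simp add: carrier_mpoly_ring_iff mpoly_var_def)

lemma mpoly_carrier_sum:
  "(\<And>i. i \<in> S \<Longrightarrow> f i \<in> carrier (mpoly_ring l)) \<Longrightarrow> sum f S \<in> carrier (mpoly_ring l)"
  by (induction S rule: infinite_finite_induct) (simp_all add: mpoly_carrier_zero mpoly_carrier_add)

lemma mpoly_carrier_prod:
  "(\<And>i. i \<in> S \<Longrightarrow> f i \<in> carrier (mpoly_ring l)) \<Longrightarrow> prod f S \<in> carrier (mpoly_ring l)"
  by (induction S rule: infinite_finite_induct) (simp_all add: mpoly_carrier_one mpoly_carrier_mult)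

lemma mpoly_carrier_power:
  "p \<in> carrier (mpoly_ring l) \<Longrightarrow> p ^ n \<in> carrier (mpoly_ring l)"
  by (induction n) (simp_all add: mpoly_carrier_one mpoly_carrier_mult)

lemma restrict_vars_carrier: "restrict_vars {..<l} p \<in> carrier (mpoly_ring l)"
  unfolding restrict_vars_def poly_eval_def monom_eval_def
  by (intro mpoly_carrier_sum mpoly_carrier_mult mpoly_carrier_prod mpoly_carrier_power mpoly_carrier_const)
     (auto simp: mpoly_carrier_var mpoly_carrier_zero)

lemma restrict_vars_id:
  assumes "p \<in> carrier (mpoly_ring l)"
  shows "restrict_vars {..<l} p = p"
proof -
  have "restrict_vars {..<l} p = poly_eval mpoly_const mpoly_var p"
    unfolding restrict_vars_def
    by (rule poly_eval_cong) (use assms in \<open>auto simp: carrier_mpoly_ring_iff\<close>)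
  then show ?thesis by (simp add: mpoly_eq_poly_eval)
qed

lemma mpoly_ring_cring: "cring (mpoly_ring l :: ('a::field mpoly) ring)"
proof (rule cringI)
  let ?R = "mpoly_ring l :: ('a mpoly) ring"
  show "abelian_group ?R"
  proof (rule abelian_groupI)
    fix x :: "'a mpoly" assume "x \<in> carrier ?R"
    then show "\<exists>y\<in>carrier ?R. y \<oplus>\<^bsub>?R\<^esub> x = \<zero>\<^bsub>?R\<^esub>"
      by (intro bexI[of _ "- x"]) (simp_all add: mpoly_carrier_uminus)
  qed (simp_all add: mpoly_carrier_zero mpoly_carrier_add add_ac)
  show "comm_monoid ?R"
    by (rule comm_monoidI) (simp_all add: mpoly_carrier_one mpoly_carrier_mult mult_ac)
qed (simp_all add: distrib_right)


section \<open>The upper bound\<close>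

text \<open>Induction on the equations \<open>T\<close>: an unknown with nonzero coefficient in
  equation \<open>t\<close> is eliminated together with \<open>t\<close>, which preserves the
  surplus of unknowns.\<close>

lemma homogeneous_system_nontrivial:
  fixes M :: "'s \<Rightarrow> 't \<Rightarrow> 'a::field"
  assumes "finite T" "finite S" "card T < card S"
  shows "\<exists>v. (\<exists>s\<in>S. v s \<noteq> 0) \<and> (\<forall>t\<in>T. (\<Sum>s\<in>S. v s * M s t) = 0)"
  using assms
proof (induction T arbitrary: S M rule: finite_induct)
  case empty
  then obtain s where "s \<in> S" by fastforce
  then show ?case by (intro exI[of _ "\<lambda>_. 1"]) auto
next
  case (insert t T)
  show ?case
  proof (cases "\<forall>s\<in>S. M s t = 0")
    case True
    have "card T < card S" using insert by simp
    with insert.IH[of S M] insert.prems obtain v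
      where "\<exists>s\<in>S. v s \<noteq> 0" "\<forall>t\<in>T. (\<Sum>s\<in>S. v s * M s t) = 0" by auto
    with True show ?thesis by (intro exI[of _ v]) auto
  next
    case False
    then obtain s0 where s0: "s0 \<in> S" "M s0 t \<noteq> 0" by blast
    define S' where "S' = S - {s0}"
    have S': "finite S'" "card T < card S'" "S = insert s0 S'" "s0 \<notin> S'"
      using insert.prems insert.hyps s0(1) by (simp_all add: S'_def insert_absorb)
    \<comment> \<open>Solving equation \<open>t\<close> for the unknown \<open>s0\<close> and
      substituting into the other equations gives these coefficients; in particular
      \<open>M' s t = 0\<close>.\<close>
    define M' where "M' s u = M s u - M s t / M s0 t * M s0 u" for s u
    obtain v where v: "\<exists>s\<in>S'. v s \<noteq> 0" "\<forall>u\<in>T. (\<Sum>s\<in>S'. v s * M' s u) = 0"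
      using insert.IH[OF S'(1,2), of M'] by blast
    \<comment> \<open>Back substitution: \<open>s0\<close> receives the value forced by equation
      \<open>t\<close>, and the nonzero entry of \<open>v\<close> on \<open>S'\<close> is
      untouched.\<close>
    define w where "w = v(s0 := - (\<Sum>s\<in>S'. v s * (M s t / M s0 t)))"
    have wS': "(\<Sum>s\<in>S'. w s * M s u) = (\<Sum>s\<in>S'. v s * M s u)" for u
      using S'(4) by (intro sum.cong) (auto simp: w_def)
    have sum_w: "(\<Sum>s\<in>S. w s * M s u) = (\<Sum>s\<in>S'. v s * M' s u)" for u
      unfolding S'(3) using S'(1,4)
      by (simp add: wS')
         (simp add: w_def M'_def right_diff_distrib sum_subtractf sum_distrib_right sum_distrib_left mult_ac)
    have "(\<Sum>s\<in>S'. v s * M' s t) = 0"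
      using s0(2) by (simp add: M'_def)
    then have "\<forall>u\<in>insert t T. (\<Sum>s\<in>S. w s * M s u) = 0"
      using v(2) sum_w by auto
    moreover have "\<exists>s\<in>S. w s \<noteq> 0"
      using v(1) S'(3,4) by (auto simp: w_def)
    ultimately show ?thesis by blast
  qed
qed

text \<open>The index list is a parameter so that the inner subexpressions, over
  \<open>[k..<n]\<close>, are again instances; both bounds recurse on \<open>k\<close>.\<close>

definition krull_term ::
    "(nat \<Rightarrow> 'b::comm_ring_1) \<Rightarrow> (nat \<Rightarrow> 'b) \<Rightarrow> (nat \<Rightarrow> nat) \<Rightarrow> nat list \<Rightarrow> 'b" where
  "krull_term x a e is = foldr (\<lambda>i u. x i ^ e i * (u + a i * x i)) is 1"

lemma krull_term_Nil [simp]: "krull_term x a e [] = 1"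
  by (simp add: krull_term_def)

lemma krull_term_Cons [simp]:
  "krull_term x a e (i # is) = x i ^ e i * (krull_term x a e is + a i * x i)"
  by (simp add: krull_term_def)

lemma krull_term_cong:
  "(\<And>i. i \<in> set is \<Longrightarrow> a i = a' i \<and> e i = e' i) \<Longrightarrow> krull_term x a e is = krull_term x a' e' is"
  by (induction "is") simp_all

text \<open>Factoring out the least power of the outermost variable and recursing on the terms that
  attain it amounts to isolating the lexicographically smallest monomial.\<close>

lemma krull_term_of_monomials:
  fixes \<kappa> :: "'a::field \<Rightarrow> 'b::comm_ring_1" and S :: "(nat \<Rightarrow>\<^sub>0 nat) set"
  assumes \<kappa>: "comm_ring_hom \<kappa>"
    and "finite S" "S \<noteq> {}" "\<forall>\<alpha>\<in>S. c \<alpha> \<noteq> 0"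
    and "\<forall>\<alpha>\<in>S. \<forall>\<beta>\<in>S. (\<forall>i\<in>{k..<n}. Poly_Mapping.lookup \<alpha> i = Poly_Mapping.lookup \<beta> i) \<longrightarrow> \<alpha> = \<beta>"
  shows "\<exists>a e d. d \<noteq> 0 \<and> (\<Sum>\<alpha>\<in>S. \<kappa> (c \<alpha>) * (\<Prod>i\<in>{k..<n}. x i ^ Poly_Mapping.lookup \<alpha> i))
      = \<kappa> d * krull_term x a e [k..<n]"
  using assms(2-)
proof (induction "n - k" arbitrary: k S)
  case 0
  \<comment> \<open>No variable is left to tell monomials apart, so \<open>S\<close> is a singleton
    and its coefficient serves as \<open>d\<close>.\<close>
  then have "\<forall>\<alpha>\<in>S. \<forall>\<beta>\<in>S. \<alpha> = \<beta>" by simp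
  with \<open>S \<noteq> {}\<close> obtain \<alpha> where "S = {\<alpha>}" by blast
  with 0 show ?case by (intro exI[of _ "c \<alpha>"] exI) simp
next
  case (Suc j)
  interpret \<kappa>: comm_ring_hom \<kappa> by (fact \<kappa>)
  from Suc.hyps(2) have k: "k < n" by simp
  define deg where "deg \<alpha> = Poly_Mapping.lookup \<alpha> k" for \<alpha> :: "nat \<Rightarrow>\<^sub>0 nat"
  define f where "f = Min (deg ` S)"
  define S' where "S' = {\<alpha>\<in>S. deg \<alpha> = f}"
  define P where "P \<alpha> = \<kappa> (c \<alpha>) * (\<Prod>i\<in>{Suc k..<n}. x i ^ Poly_Mapping.lookup \<alpha> i)" for \<alpha>
  have f_le: "f \<le> deg \<alpha>" if "\<alpha> \<in> S" for \<alpha>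
    using that Suc.prems by (simp add: f_def)
  have "f \<in> deg ` S"
    using Suc.prems by (simp add: f_def)
  then have ne: "S' \<noteq> {}" by (auto simp: S'_def)
  have fin: "finite S'" and sub: "S' \<subseteq> S" using Suc.prems by (auto simp: S'_def)
  have "\<exists>a e d. d \<noteq> 0 \<and> (\<Sum>\<alpha>\<in>S'. \<kappa> (c \<alpha>) * (\<Prod>i\<in>{Suc k..<n}. x i ^ Poly_Mapping.lookup \<alpha> i))
      = \<kappa> d * krull_term x a e [Suc k..<n]"
  proof (rule Suc.hyps(1))
    \<comment> \<open>Elements of \<open>S'\<close> agree at \<open>k\<close>, so those agreeing
      beyond \<open>k\<close> agree on all of \<open>{k..<n}\<close>.\<close>
    show "\<forall>\<alpha>\<in>S'. \<forall>\<beta>\<in>S'. (\<forall>i\<in>{Suc k..<n}. Poly_Mapping.lookup \<alpha> i = Poly_Mapping.lookup \<beta> i) \<longrightarrow> \<alpha> = \<beta>"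
    proof (intro ballI impI)
      fix \<alpha> \<beta> assume *: "\<alpha> \<in> S'" "\<beta> \<in> S'"
        and eq: "\<forall>i\<in>{Suc k..<n}. Poly_Mapping.lookup \<alpha> i = Poly_Mapping.lookup \<beta> i"
      have "Poly_Mapping.lookup \<alpha> i = Poly_Mapping.lookup \<beta> i" if "i \<in> {k..<n}" for i
        using eq * that by (cases "i = k") (auto simp: S'_def deg_def)
      then show "\<alpha> = \<beta>" using Suc.prems(4) * sub by blast
    qed
  qed (use Suc.hyps(2) Suc.prems fin ne sub in auto)
  then obtain a e d where d: "d \<noteq> 0" and IH: "(\<Sum>\<alpha>\<in>S'. P \<alpha>) = \<kappa> d * krull_term x a e [Suc k..<n]"
    unfolding P_def by blast
  \<comment> \<open>The terms outside \<open>S'\<close> are divisible by the power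
    \<open>Suc f\<close> of \<open>x k\<close>; \<open>Q\<close> is their sum with that power
    removed. It is divided by \<open>d\<close> in \<open>a'\<close> because the factor
    \<open>d\<close> of the inner part moves to the front.\<close>
  define Q where "Q = (\<Sum>\<alpha>\<in>S - S'. P \<alpha> * x k ^ (deg \<alpha> - Suc f))"
  define a' where "a' = a(k := \<kappa> (inverse d) * Q)"
  define e' where "e' = e(k := f)"
  have split: "{k..<n} = insert k {Suc k..<n}" using k by auto
  have "(\<Sum>\<alpha>\<in>S. \<kappa> (c \<alpha>) * (\<Prod>i\<in>{k..<n}. x i ^ Poly_Mapping.lookup \<alpha> i))
      = (\<Sum>\<alpha>\<in>S. P \<alpha> * x k ^ deg \<alpha>)"
    unfolding split by (simp add: P_def deg_def mult_ac)
  also have "\<dots> = (\<Sum>\<alpha>\<in>S'. P \<alpha> * x k ^ deg \<alpha>) + (\<Sum>\<alpha>\<in>S - S'. P \<alpha> * x k ^ deg \<alpha>)"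
    using sum.subset_diff[OF sub Suc.prems(1)] by (simp add: add.commute)
  also have "(\<Sum>\<alpha>\<in>S'. P \<alpha> * x k ^ deg \<alpha>) = x k ^ f * (\<Sum>\<alpha>\<in>S'. P \<alpha>)"
    by (simp add: S'_def sum_distrib_left mult.commute)
  also have "(\<Sum>\<alpha>\<in>S - S'. P \<alpha> * x k ^ deg \<alpha>) = x k ^ f * (Q * x k)"
  proof -
    have "P \<alpha> * x k ^ deg \<alpha> = x k ^ f * (P \<alpha> * x k ^ (deg \<alpha> - Suc f) * x k)" if "\<alpha> \<in> S - S'" for \<alpha>
    proof -
      have "f < deg \<alpha>" using f_le[of \<alpha>] that by (auto simp: S'_def)
      then have "deg \<alpha> = Suc (f + (deg \<alpha> - Suc f))" by simp
      then have "x k ^ deg \<alpha> = x k * (x k ^ f * x k ^ (deg \<alpha> - Suc f))"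
        by (metis power_Suc power_add)
      then show ?thesis by (simp add: mult_ac)
    qed
    then show ?thesis by (simp add: Q_def sum_distrib_left sum_distrib_right)
  qed
  also have "x k ^ f * (\<Sum>\<alpha>\<in>S'. P \<alpha>) + x k ^ f * (Q * x k)
      = \<kappa> d * (x k ^ f * (krull_term x a e [Suc k..<n] + \<kappa> (inverse d) * Q * x k))"
  proof -
    have "\<kappa> d * \<kappa> (inverse d) = 1"
      using d by (simp add: \<kappa>.one flip: \<kappa>.mult)
    then have "Q * x k = \<kappa> d * (\<kappa> (inverse d) * Q * x k)"
      by (simp add: mult.assoc[symmetric])
    then show ?thesis unfolding IH by (simp add: algebra_simps)
  qed
  also have "krull_term x a e [Suc k..<n] = krull_term x a' e' [Suc k..<n]"
    by (rule krull_term_cong) (simp add: a'_def e'_def)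
  finally show ?case
    using d k by (intro exI[of _ a'] exI[of _ e'] exI[of _ d]) (simp add: upt_conv_Cons a'_def e'_def)
qed

text \<open>Applied to the support of \<open>p\<close>: monomials in the first \<open>n\<close>
  variables are determined by their exponents on \<open>{0..<n}\<close>.\<close>

lemma krull_term_of_poly_eval:
  fixes \<kappa> :: "'a::field \<Rightarrow> 'b::comm_ring_1"
  assumes "comm_ring_hom \<kappa>" "p \<in> carrier (mpoly_ring n)" "p \<noteq> 0"
  shows "\<exists>a e d. d \<noteq> 0 \<and> poly_eval \<kappa> x p = \<kappa> d * krull_term x a e [0..<n]"
proof -
  have sub: "Poly_Mapping.keys m \<subseteq> {0..<n}" if "m \<in> Poly_Mapping.keys p" for m
    using assms(2) that by (auto simp: carrier_mpoly_ring_iff atLeast0LessThan)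
  have inj: "m = m'"
    if "m \<in> Poly_Mapping.keys p" "m' \<in> Poly_Mapping.keys p"
      "\<forall>i\<in>{0..<n}. Poly_Mapping.lookup m i = Poly_Mapping.lookup m' i" for m m'
  proof (rule poly_mapping_eqI)
    fix i show "Poly_Mapping.lookup m i = Poly_Mapping.lookup m' i"
      using that sub by (metis in_keys_iff subsetD)
  qed
  have "poly_eval \<kappa> x p = (\<Sum>m\<in>Poly_Mapping.keys p. \<kappa> (Poly_Mapping.lookup p m) *
      (\<Prod>i\<in>{0..<n}. x i ^ Poly_Mapping.lookup m i))"
    unfolding poly_eval_def using sub by (auto intro!: sum.cong simp: monom_eval_superset[of "{0..<n}"])
  moreover have "Poly_Mapping.keys p \<noteq> {}"
    using assms(3) by simp
  moreover have "\<forall>m\<in>Poly_Mapping.keys p. Poly_Mapping.lookup p m \<noteq> 0"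
    by (simp add: in_keys_iff)
  ultimately show ?thesis
    using krull_term_of_monomials[OF assms(1) finite_keys, of p "Poly_Mapping.lookup p" 0 n x] inj
    by simp
qed


section \<open>Counting monomials with bounded exponents\<close>

definition monoms_le :: "nat \<Rightarrow> nat \<Rightarrow> (nat \<Rightarrow>\<^sub>0 nat) set" where
  "monoms_le r d = {m. Poly_Mapping.keys m \<subseteq> {..<r} \<and> (\<forall>i. Poly_Mapping.lookup m i \<le> d)}"

lemma bij_betw_monoms_le:
  "bij_betw (\<lambda>m. restrict (Poly_Mapping.lookup m) {..<r}) (monoms_le r d) (PiE {..<r} (\<lambda>_. {..d}))"
proof (rule bij_betw_imageI)
  show "inj_on (\<lambda>m. restrict (Poly_Mapping.lookup m) {..<r}) (monoms_le r d)"
  proof (intro inj_onI poly_mapping_eqI)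
    fix m m' :: "nat \<Rightarrow>\<^sub>0 nat" and i
    assume m: "m \<in> monoms_le r d" "m' \<in> monoms_le r d"
      and eq: "restrict (Poly_Mapping.lookup m) {..<r} = restrict (Poly_Mapping.lookup m') {..<r}"
    show "Poly_Mapping.lookup m i = Poly_Mapping.lookup m' i"
    proof (cases "i < r")
      case True
      then show ?thesis using fun_cong[OF eq, of i] by simp
    next
      case False
      then have "i \<notin> Poly_Mapping.keys m" "i \<notin> Poly_Mapping.keys m'"
        using m unfolding monoms_le_def by auto
      then show ?thesis by (simp add: in_keys_iff)
    qed
  qed
  have "f \<in> (\<lambda>m. restrict (Poly_Mapping.lookup m) {..<r}) ` monoms_le r d"
    if f: "f \<in> PiE {..<r} (\<lambda>_. {..d})" for f
  proof
    let ?m = "Abs_poly_mapping (\<lambda>i. if i < r then f i else 0)"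
    have lookup: "Poly_Mapping.lookup ?m = (\<lambda>i. if i < r then f i else 0)"
      by (rule lookup_Abs_poly_mapping) (auto intro: finite_subset[of _ "{..<r}"])
    show "f = restrict (Poly_Mapping.lookup ?m) {..<r}"
      unfolding lookup using PiE_arb[OF f] by (fastforce simp: restrict_def)
    have "f i \<le> d" if "i < r" for i
      using PiE_mem[OF f, of i] that by simp
    moreover have "Poly_Mapping.keys ?m \<subseteq> {..<r}"
    proof
      fix i assume "i \<in> Poly_Mapping.keys ?m"
      then show "i \<in> {..<r}" unfolding in_keys_iff lookup by (simp split: if_splits)
    qed
    ultimately show "?m \<in> monoms_le r d"
      by (simp add: monoms_le_def lookup)
  qed
  moreover have "restrict (Poly_Mapping.lookup m) {..<r} \<in> PiE {..<r} (\<lambda>_. {..d})"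
    if "m \<in> monoms_le r d" for m
    using that by (simp add: restrict_PiE_iff monoms_le_def)
  ultimately show "(\<lambda>m. restrict (Poly_Mapping.lookup m) {..<r}) ` monoms_le r d = PiE {..<r} (\<lambda>_. {..d})"
    by blast
qed

text \<open>Bounding each exponent separately, not the total degree, makes the count a pure
  power.\<close>

lemma card_monoms_le: "card (monoms_le r d) = Suc d ^ r"
  using bij_betw_same_card[OF bij_betw_monoms_le[of r d]] by (simp add: card_PiE)

lemma finite_monoms_le [simp]: "finite (monoms_le r d)"
  using bij_betw_finite[OF bij_betw_monoms_le[of r d]] by (simp add: finite_PiE)

lemma monoms_le_mono:
  assumes "d \<le> d'"
  shows "monoms_le r d \<subseteq> monoms_le r d'"
  using order_trans[OF _ assms] by (auto simp: monoms_le_def)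

lemma keys_mult_monoms_le:
  assumes "Poly_Mapping.keys p \<subseteq> monoms_le r d" "Poly_Mapping.keys q \<subseteq> monoms_le r d'"
  shows "Poly_Mapping.keys (p * q) \<subseteq> monoms_le r (d + d')"
proof
  fix m assume "m \<in> Poly_Mapping.keys (p * q)"
  then obtain a b where "a \<in> Poly_Mapping.keys p" "b \<in> Poly_Mapping.keys q" "m = a + b"
    using keys_mult[of p q] by auto
  then show "m \<in> monoms_le r (d + d')"
    using assms Poly_Mapping.keys_add[of a b] unfolding monoms_le_def
    by (fastforce simp: lookup_add intro: add_mono)
qed

lemma keys_sum_subset:
  assumes "\<And>i. i \<in> S \<Longrightarrow> Poly_Mapping.keys (f i) \<subseteq> B"
  shows "Poly_Mapping.keys (sum f S) \<subseteq> B"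
  using assms
proof (induction S rule: infinite_finite_induct)
  case (insert i S)
  then show ?case using Poly_Mapping.keys_add[of "f i" "sum f S"] by auto
qed simp_all

lemma mpoly_carrier_monoms_le:
  assumes "p \<in> carrier (mpoly_ring r)"
  shows "\<exists>d. Poly_Mapping.keys p \<subseteq> monoms_le r d"
proof -
  let ?E = "\<Union>m\<in>Poly_Mapping.keys p. Poly_Mapping.lookup m ` Poly_Mapping.keys m"
  have "Poly_Mapping.lookup m i \<le> Max (insert 0 ?E)" if "m \<in> Poly_Mapping.keys p" for m i
    using that by (cases "i \<in> Poly_Mapping.keys m") (auto simp: in_keys_iff intro!: Max_ge)
  then show ?thesis
    using assms unfolding monoms_le_def carrier_mpoly_ring_iff by blast
qed

text \<open>The quotient by \<open>J\<close> is a module generated by the \<open>b k\<close> over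
  the polynomials in the \<open>y i\<close>. Congruences modulo \<open>J\<close> replace the
  quotient ring; in the application \<open>J\<close> is the kernel of a surjection onto
  \<open>A\<close>.\<close>

locale finite_over_polynomials = \<kappa>: comm_ring_hom \<kappa> + J: ring_ideal J
  for \<kappa> :: "'a::field \<Rightarrow> 'b::comm_ring_1" and J :: "'b set" +
  fixes r n :: nat and y b :: "nat \<Rightarrow> 'b"
  assumes spans: "\<exists>p. (\<forall>k<n. p k \<in> carrier (mpoly_ring r)) \<and>
      z - (\<Sum>k<n. poly_eval \<kappa> y (p k) * b k) \<in> J"
begin

sublocale ev: comm_ring_hom "poly_eval \<kappa> y"
  by (rule poly_eval_hom) unfold_locales

text \<open>A filtration by exponent bound: modulo \<open>J\<close>, level \<open>d\<close> is
  spanned over the field by the at most \<open>n * (d + 1) ^ r\<close> products of a bounded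
  monomial in \<open>y\<close> with some \<open>b k\<close>.\<close>

definition span_le :: "nat \<Rightarrow> 'b set" where
  "span_le d = {z. \<exists>p. (\<forall>k<n. Poly_Mapping.keys (p k) \<subseteq> monoms_le r d) \<and>
      z - (\<Sum>k<n. poly_eval \<kappa> y (p k) * b k) \<in> J}"

lemma span_le_mono:
  assumes "d \<le> d'"
  shows "span_le d \<subseteq> span_le d'"
proof
  fix z assume "z \<in> span_le d"
  then obtain p where "\<forall>k<n. Poly_Mapping.keys (p k) \<subseteq> monoms_le r d"
    "z - (\<Sum>k<n. poly_eval \<kappa> y (p k) * b k) \<in> J"
    unfolding span_le_def by blast
  moreover have "\<forall>k<n. Poly_Mapping.keys (p k) \<subseteq> monoms_le r d'"
    using calculation(1) monoms_le_mono[OF assms, of r] by (auto dest: subsetD)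
  ultimately show "z \<in> span_le d'"
    unfolding span_le_def by blast
qed

lemma ex_span_le: "\<exists>d. z \<in> span_le d"
proof -
  obtain p where p: "\<And>k. k < n \<Longrightarrow> p k \<in> carrier (mpoly_ring r)"
    "z - (\<Sum>k<n. poly_eval \<kappa> y (p k) * b k) \<in> J"
    using spans[of z] by blast
  obtain d where d: "\<And>k. k < n \<Longrightarrow> Poly_Mapping.keys (p k) \<subseteq> monoms_le r (d k)"
    using mpoly_carrier_monoms_le[OF p(1)] by metis
  have "Poly_Mapping.keys (p k) \<subseteq> monoms_le r (Max (d ` {..<n}))" if "k < n" for k
    using d[OF that] monoms_le_mono[of "d k" "Max (d ` {..<n})" r] that by fastforce
  then show ?thesis using p(2) unfolding span_le_def by blast
qed

lemma finite_span_le: "finite Z \<Longrightarrow> \<exists>d. Z \<subseteq> span_le d"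
proof (induction Z rule: finite_induct)
  case (insert z Z)
  then obtain d where d: "Z \<subseteq> span_le d" by blast
  obtain d' where "z \<in> span_le d'" using ex_span_le by blast
  with d show ?case
    using span_le_mono[of d "max d d'"] span_le_mono[of d' "max d d'"]
    by (intro exI[of _ "max d d'"]) auto
qed simp

text \<open>Expanding \<open>z\<close> in the \<open>b k\<close> and then each
  \<open>x * b k\<close> once more multiplies coefficients, so a factor \<open>x\<close> raises the
  level by \<open>D\<close>, whatever \<open>d\<close> is.\<close>

lemma span_le_mult:
  assumes x: "\<And>k. k < n \<Longrightarrow> x * b k \<in> span_le D" and z: "z \<in> span_le d"
  shows "x * z \<in> span_le (d + D)"
proof -
  obtain p where p: "\<And>k. k < n \<Longrightarrow> Poly_Mapping.keys (p k) \<subseteq> monoms_le r d"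
    "z - (\<Sum>k<n. poly_eval \<kappa> y (p k) * b k) \<in> J"
    using z unfolding span_le_def by blast
  have "\<exists>q. \<forall>k<n. (\<forall>i<n. Poly_Mapping.keys (q k i) \<subseteq> monoms_le r D) \<and>
      x * b k - (\<Sum>i<n. poly_eval \<kappa> y (q k i) * b i) \<in> J"
    using x unfolding span_le_def by (auto intro!: choice)
  then obtain q where q: "\<And>k i. k < n \<Longrightarrow> i < n \<Longrightarrow> Poly_Mapping.keys (q k i) \<subseteq> monoms_le r D"
    "\<And>k. k < n \<Longrightarrow> x * b k - (\<Sum>i<n. poly_eval \<kappa> y (q k i) * b i) \<in> J" by blast
  define s where "s i = (\<Sum>k<n. p k * q k i)" for i
  have "Poly_Mapping.keys (s i) \<subseteq> monoms_le r (d + D)" if "i < n" for i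
    unfolding s_def using p(1) q(1) that by (intro keys_sum_subset keys_mult_monoms_le) auto
  moreover have "x * z - (\<Sum>i<n. poly_eval \<kappa> y (s i) * b i) \<in> J"
  proof -
    have "(\<Sum>i<n. poly_eval \<kappa> y (s i) * b i)
        = (\<Sum>i<n. \<Sum>k<n. poly_eval \<kappa> y (p k) * (poly_eval \<kappa> y (q k i) * b i))"
      by (simp add: s_def ev.simps sum_distrib_right mult.assoc)
    also have "\<dots> = (\<Sum>k<n. poly_eval \<kappa> y (p k) * (\<Sum>i<n. poly_eval \<kappa> y (q k i) * b i))"
      by (subst sum.swap) (simp add: sum_distrib_left)
    \<comment> \<open>The error is \<open>x\<close> times the error of \<open>z\<close> plus a
      combination of the errors of the \<open>x * b k\<close>.\<close>
    finally have "x * z - (\<Sum>i<n. poly_eval \<kappa> y (s i) * b i) = x * (z - (\<Sum>k<n. poly_eval \<kappa> y (p k) * b k))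
        + (\<Sum>k<n. poly_eval \<kappa> y (p k) * (x * b k - (\<Sum>i<n. poly_eval \<kappa> y (q k i) * b i)))"
      by (simp add: right_diff_distrib sum_subtractf sum_distrib_left mult_ac)
    then show ?thesis
      by (auto intro!: J.add J.mult J.sum p q)
  qed
  ultimately show ?thesis unfolding span_le_def by blast
qed

lemma span_le_power_mult:
  assumes "\<And>k. k < n \<Longrightarrow> x * b k \<in> span_le D" and "z \<in> span_le d"
  shows "x ^ e * z \<in> span_le (d + D * e)"
  using assms(2)
proof (induction e)
  case (Suc e)
  then show ?case
    using span_le_mult[OF assms(1), of "x ^ e * z" "d + D * e"] by (simp add: mult_ac add_ac)
qed simp

text \<open>Every factor costs \<open>D\<close>, so the level grows linearly with the total
  exponent; the initial \<open>D\<close> accounts for the empty product 1.\<close>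

lemma span_le_prod:
  assumes "\<And>i k. i \<in> S \<Longrightarrow> k < n \<Longrightarrow> x i * b k \<in> span_le D" and "1 \<in> span_le D"
  shows "(\<Prod>i\<in>S. x i ^ e i) \<in> span_le (D + D * (\<Sum>i\<in>S. e i))"
  using assms(1)
proof (induction S rule: infinite_finite_induct)
  case (insert i S)
  then show ?case
    using span_le_power_mult[of "x i" D "\<Prod>i\<in>S. x i ^ e i" "D + D * (\<Sum>i\<in>S. e i)" "e i"]
    by (simp add: algebra_simps)
qed (use assms(2) in simp_all)

text \<open>There are \<open>(N + 1)^(r + 1)\<close> monomials in the \<open>x i\<close> with exponents at most \<open>N\<close>, but modulo \<open>J\<close>
  they lie in a space of dimension \<open>O(N^r)\<close>.\<close>

theorem algebraically_dependent:
  "\<exists>p \<in> carrier (mpoly_ring (Suc r)). p \<noteq> 0 \<and> poly_eval \<kappa> x p \<in> J"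
proof -
  \<comment> \<open>Finitely many elements are involved, so a single level \<open>D\<close> serves
    all of them.\<close>
  have "finite (insert 1 ((\<lambda>(i, k). x i * b k) ` ({..<Suc r} \<times> {..<n})))" by simp
  from finite_span_le[OF this] obtain D where
    "insert 1 ((\<lambda>(i, k). x i * b k) ` ({..<Suc r} \<times> {..<n})) \<subseteq> span_le D" by blast
  then have D: "1 \<in> span_le D" "\<And>i k. i \<in> {..<Suc r} \<Longrightarrow> k < n \<Longrightarrow> x i * b k \<in> span_le D"
    by (auto simp: image_subset_iff simp del: lessThan_Suc)
  \<comment> \<open>\<open>D'\<close> is a level containing all monomials in \<open>x\<close> with
    exponents at most \<open>N\<close>. \<open>C\<close> is chosen to give
    \<open>Suc D' \<le> C * Suc N\<close>, and \<open>N\<close> so that the number of coordinates is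
    at most \<open>N * Suc N ^ r\<close>, below the number \<open>Suc N ^ Suc r\<close> of
    monomials.\<close>
  define C where "C = D * (r + 2) + 1"
  define N where "N = n * C ^ r"
  define D' where "D' = D + D * (Suc r * N)"
  let ?E = "monoms_le (Suc r) N" and ?T = "{..<n} \<times> monoms_le r D'"
  have "\<exists>p. (\<forall>k<n. Poly_Mapping.keys (p k) \<subseteq> monoms_le r D') \<and>
      monom_eval x \<alpha> - (\<Sum>k<n. poly_eval \<kappa> y (p k) * b k) \<in> J" if \<alpha>: "\<alpha> \<in> ?E" for \<alpha>
  proof -
    have "monom_eval x \<alpha> = (\<Prod>i\<in>{..<Suc r}. x i ^ Poly_Mapping.lookup \<alpha> i)"
      using \<alpha> by (intro monom_eval_superset) (auto simp: monoms_le_def)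
    also have "\<dots> \<in> span_le (D + D * (\<Sum>i\<in>{..<Suc r}. Poly_Mapping.lookup \<alpha> i))"
      by (rule span_le_prod) (use D in auto)
    also have "(\<Sum>i\<in>{..<Suc r}. Poly_Mapping.lookup \<alpha> i) \<le> Suc r * N"
      using sum_bounded_above[of "{..<Suc r}" "Poly_Mapping.lookup \<alpha>" N] \<alpha>
      by (simp add: monoms_le_def)
    then have "span_le (D + D * (\<Sum>i\<in>{..<Suc r}. Poly_Mapping.lookup \<alpha> i)) \<subseteq> span_le D'"
      unfolding D'_def by (intro span_le_mono add_mono mult_le_mono) auto
    finally show ?thesis unfolding span_le_def by blast
  qed
  then obtain P where P: "\<And>\<alpha> k. \<alpha> \<in> ?E \<Longrightarrow> k < n \<Longrightarrow> Poly_Mapping.keys (P \<alpha> k) \<subseteq> monoms_le r D'"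
    "\<And>\<alpha>. \<alpha> \<in> ?E \<Longrightarrow> monom_eval x \<alpha> - (\<Sum>k<n. poly_eval \<kappa> y (P \<alpha> k) * b k) \<in> J"
    by metis
  have "card ?T < card ?E"
  proof -
    have "Suc D' \<le> C * Suc N"
      by (simp add: C_def D'_def algebra_simps)
    then have "n * Suc D' ^ r \<le> n * (C * Suc N) ^ r"
      by (intro mult_le_mono power_mono) auto
    also have "\<dots> = N * Suc N ^ r"
      unfolding power_mult_distrib by (simp add: N_def)
    also have "\<dots> < Suc N ^ Suc r" by simp
    finally show ?thesis by (simp add: card_cartesian_product card_monoms_le)
  qed
  \<comment> \<open>The unknowns are the coefficients of the monomials in \<open>x\<close>; the
    equation for \<open>(k, m)\<close> says that the coefficient of \<open>m\<close> cancels in the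
    combined \<open>k\<close>-th coordinate.\<close>
  then obtain v where v: "\<exists>\<alpha>\<in>?E. v \<alpha> \<noteq> 0"
    "\<forall>(k, m)\<in>?T. (\<Sum>\<alpha>\<in>?E. v \<alpha> * Poly_Mapping.lookup (P \<alpha> k) m) = 0"
    using homogeneous_system_nontrivial[of ?T ?E "\<lambda>\<alpha> (k, m). Poly_Mapping.lookup (P \<alpha> k) m"]
    by (auto simp: split_beta)
  define p where "p = (\<Sum>\<alpha>\<in>?E. Poly_Mapping.single \<alpha> (v \<alpha>))"
  have "Poly_Mapping.lookup p \<alpha> = v \<alpha>" if "\<alpha> \<in> ?E" for \<alpha>
    using that by (simp add: p_def lookup_sum lookup_single when_def)
  then have "p \<noteq> 0" using v(1) by fastforce
  moreover have "p \<in> carrier (mpoly_ring (Suc r))"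
    unfolding p_def by (intro mpoly_carrier_sum) (auto simp: carrier_mpoly_ring_iff monoms_le_def)
  moreover have "poly_eval \<kappa> x p \<in> J"
  proof -
    have \<kappa>: "comm_ring_hom \<kappa>" by unfold_locales
    have ev: "poly_eval \<kappa> x p = (\<Sum>\<alpha>\<in>?E. \<kappa> (v \<alpha>) * monom_eval x \<alpha>)"
      by (simp add: p_def poly_eval_sum[OF \<kappa>] poly_eval_single[OF \<kappa>])
    \<comment> \<open>Collected by monomials \<open>m\<close> in \<open>y\<close>, the coefficients
      are the left-hand sides of the equations solved by \<open>v\<close>.\<close>
    have "(\<Sum>\<alpha>\<in>?E. \<kappa> (v \<alpha>) * poly_eval \<kappa> y (P \<alpha> k)) = 0" if "k < n" for k
    proof -
      have "(\<Sum>\<alpha>\<in>?E. \<kappa> (v \<alpha>) * poly_eval \<kappa> y (P \<alpha> k))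
          = (\<Sum>\<alpha>\<in>?E. \<Sum>m\<in>monoms_le r D'. \<kappa> (v \<alpha> * Poly_Mapping.lookup (P \<alpha> k) m) * monom_eval y m)"
        using P(1) that
        by (intro sum.cong refl)
           (simp add: poly_eval_superset[OF \<kappa>, of "monoms_le r D'"] sum_distrib_left \<kappa>.mult mult.assoc)
      also have "\<dots> = (\<Sum>m\<in>monoms_le r D'. \<kappa> (\<Sum>\<alpha>\<in>?E. v \<alpha> * Poly_Mapping.lookup (P \<alpha> k) m) * monom_eval y m)"
        by (subst sum.swap) (simp add: \<kappa>.sum sum_distrib_right)
      also have "\<dots> = 0"
        using v(2) that by (auto simp: \<kappa>.zero intro!: sum.neutral)
      finally show ?thesis .
    qed
    then have "(\<Sum>k<n. (\<Sum>\<alpha>\<in>?E. \<kappa> (v \<alpha>) * poly_eval \<kappa> y (P \<alpha> k)) * b k) = 0"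
      by simp
    then have "(\<Sum>\<alpha>\<in>?E. \<kappa> (v \<alpha>) * (\<Sum>k<n. poly_eval \<kappa> y (P \<alpha> k) * b k)) = 0"
      unfolding sum_distrib_left sum_distrib_right by (subst sum.swap) (simp add: mult.assoc)
    \<comment> \<open>Since the representatives cancel, only their errors remain, and these lie in
      \<open>J\<close>.\<close>
    then have "poly_eval \<kappa> x p
        = (\<Sum>\<alpha>\<in>?E. \<kappa> (v \<alpha>) * (monom_eval x \<alpha> - (\<Sum>k<n. poly_eval \<kappa> y (P \<alpha> k) * b k)))"
      by (simp add: ev right_diff_distrib sum_subtractf)
    also have "\<dots> \<in> J" by (intro J.sum J.mult P)
    finally show ?thesis .
  qed
  ultimately show ?thesis by blast
qed

text \<open>The constant in front of the nested expression is the image of a nonzero field element,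
  so it can be divided out inside the ideal.\<close>

lemma krull_term_mem: "\<exists>a e. krull_term x a e [0..<Suc r] \<in> J"
proof -
  obtain p where p: "p \<in> carrier (mpoly_ring (Suc r))" "p \<noteq> 0" "poly_eval \<kappa> x p \<in> J"
    using algebraically_dependent by blast
  have "comm_ring_hom \<kappa>" by unfold_locales
  from krull_term_of_poly_eval[OF this p(1,2)] obtain a e d
    where d: "d \<noteq> 0" "poly_eval \<kappa> x p = \<kappa> d * krull_term x a e [0..<Suc r]" by blast
  then have "\<kappa> (inverse d) * (\<kappa> d * krull_term x a e [0..<Suc r]) \<in> J"
    using p(3) J.mult by metis
  moreover have "\<kappa> (inverse d) * \<kappa> d = 1"
    using d(1) by (simp add: \<kappa>.one flip: \<kappa>.mult)
  ultimately have "krull_term x a e [0..<Suc r] \<in> J"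
    by (simp add: mult.assoc[symmetric] del: upt_Suc)
  then show ?thesis by blast
qed

end


section \<open>The lower bound\<close>

text \<open>A substitute for Cramer's rule: modulo \<open>N\<close> the matrix \<open>P\<close> is diagonal with entries in \<open>U\<close>, and
  Gaussian elimination, cross-multiplying instead of dividing, preserves this shape.\<close>

lemma elimination:
  fixes L :: "('i \<Rightarrow> 'p::comm_ring_1) set" and U N :: "'p set" and P :: "'i \<Rightarrow> 'i \<Rightarrow> 'p"
  assumes L: "\<And>w w'. w \<in> L \<Longrightarrow> w' \<in> L \<Longrightarrow> (\<lambda>i. w i + w' i) \<in> L"
      "\<And>c w. w \<in> L \<Longrightarrow> (\<lambda>i. c * w i) \<in> L"
    and U: "1 \<in> U" "\<And>u v. u \<in> U \<Longrightarrow> v \<in> U \<Longrightarrow> u * v \<in> U" "\<And>u z. u \<in> U \<Longrightarrow> z \<in> N \<Longrightarrow> u + z \<in> U"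
    and N: "ring_ideal N"
    and T: "finite T"
    and P: "\<And>i. i \<in> T \<Longrightarrow> P i \<in> L" "\<And>i. i \<in> T \<Longrightarrow> P i i \<in> U"
      "\<And>i j. i \<in> T \<Longrightarrow> j \<noteq> i \<Longrightarrow> P i j \<in> N" "\<And>i j. i \<in> T \<Longrightarrow> j \<notin> T \<Longrightarrow> P i j = 0"
  shows "\<exists>Q\<in>U. \<forall>k\<in>T. (\<lambda>j. if j = k then Q else 0) \<in> L"
  using T P
proof (induction T arbitrary: P rule: finite_induct)
  case empty
  then show ?case using U(1) by auto
next
  case (insert t T)
  interpret N: ring_ideal N by (fact N)
  have lin: "(\<lambda>j. c * w j + d * w' j) \<in> L" if "w \<in> L" "w' \<in> L" for c d w w'
    using L(1)[OF L(2)[OF that(1)] L(2)[OF that(2)]] .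
  \<comment> \<open>The row operation that clears column \<open>t\<close>: the two contributions to
    \<open>P' i t\<close> cancel.\<close>
  define P' where "P' i = (\<lambda>j. P t t * P i j + (- P i t) * P t j)" for i
  have "\<exists>Q\<in>U. \<forall>k\<in>T. (\<lambda>j. if j = k then Q else 0) \<in> L"
  proof (rule insert.IH[of P'])
    fix i assume i: "i \<in> T"
    then have "i \<noteq> t" using insert.hyps by blast
    show "P' i \<in> L"
      unfolding P'_def using i insert.prems(1) by (intro lin) auto
    \<comment> \<open>The new diagonal entry is a product of two elements of \<open>U\<close>
      corrected by an element of \<open>N\<close>.\<close>
    have "- P i t * P t i \<in> N"
      using i \<open>i \<noteq> t\<close> insert.prems(3)[of t i] by (intro N.mult) auto
    then show "P' i i \<in> U"
      unfolding P'_def using i insert.prems(2) by (intro U(3) U(2)) auto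
    show "P' i j \<in> N" if "j \<noteq> i" for j
    proof -
      have "P i t \<in> N" "P i j \<in> N"
        using i \<open>i \<noteq> t\<close> that insert.prems(3)[of i] by auto
      then show ?thesis unfolding P'_def by (intro N.add N.mult N.mult_right N.uminus)
    qed
    show "P' i j = 0" if "j \<notin> T" for j
      using that i insert.prems(4)[of i j] insert.prems(4)[of t j]
      by (cases "j = t") (auto simp: P'_def)
  qed
  then obtain Q where Q: "Q \<in> U" "\<And>k. k \<in> T \<Longrightarrow> (\<lambda>j. if j = k then Q else 0) \<in> L" by blast
  \<comment> \<open>Back substitution: the entries of \<open>Q\<close> times row \<open>t\<close> in
    the columns \<open>S\<close> are removed one at a time with the diagonal vectors already
    found.\<close>
  have "(\<lambda>j. if j = t then Q * P t t else if j \<in> T - S then Q * P t j else 0) \<in> L"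
    if "S \<subseteq> T" for S
    using finite_subset[OF that insert.hyps(1)] that
  proof (induction S rule: finite_induct)
    case empty
    have "(\<lambda>j. if j = t then Q * P t t else if j \<in> T - {} then Q * P t j else 0) = (\<lambda>j. Q * P t j)"
      using insert.prems(4)[of t] by (auto simp: fun_eq_iff)
    then show ?case using L(2) insert.prems(1) by auto
  next
    case (insert s S)
    have "s \<noteq> t" using insert.prems \<open>t \<notin> T\<close> by blast
    have "(\<lambda>j. if j = t then Q * P t t else if j \<in> T - insert s S then Q * P t j else 0)
        = (\<lambda>j. 1 * (if j = t then Q * P t t else if j \<in> T - S then Q * P t j else 0)
            + (- P t s) * (if j = s then Q else 0))"
      using insert \<open>s \<noteq> t\<close> by (auto simp: fun_eq_iff mult.commute)
    also have "\<dots> \<in> L"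
      using insert by (intro lin Q) auto
    finally show ?case .
  qed
  from this[of T] have t: "(\<lambda>j. if j = t then Q * P t t else 0) \<in> L"
    by (simp add: if_distrib cong: if_cong)
  \<comment> \<open>The other diagonal vectors are scaled by \<open>P t t\<close>, so that one
    common entry works for every \<open>k\<close>.\<close>
  have "(\<lambda>j. if j = k then Q * P t t else 0) \<in> L" if "k \<in> insert t T" for k
  proof (cases "k = t")
    case False
    then have "(\<lambda>j. P t t * (if j = k then Q else 0)) \<in> L"
      using that by (intro L(2) Q) auto
    moreover have "(\<lambda>j. P t t * (if j = k then Q else 0)) = (\<lambda>j. if j = k then Q * P t t else 0)"
      by (auto simp: mult.commute)
    ultimately show ?thesis by simp
  qed (use t in simp)
  then show ?case using U(2)[OF Q(1), of "P t t"] insert.prems(2) by auto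
qed

section \<open>Principal ideals, saturations and sums with a principal ideal\<close>

lemma ring_ideal_principal: "ring_ideal {x. Y dvd x}" for Y :: "'p::comm_ring_1"
  by unfold_locales auto

lemma ring_ideal_saturation:
  assumes "ring_ideal J"
  shows "ring_ideal {x. \<exists>m. t ^ m * x \<in> J}"
proof -
  interpret ring_ideal J by fact
  show ?thesis
  proof
    show "0 \<in> {x. \<exists>m. t ^ m * x \<in> J}" by (simp add: zero)
    show "x + y \<in> {x. \<exists>m. t ^ m * x \<in> J}"
      if xy: "x \<in> {x. \<exists>m. t ^ m * x \<in> J}" "y \<in> {x. \<exists>m. t ^ m * x \<in> J}" for x y
    proof -
      obtain k m where km: "t ^ k * x \<in> J" "t ^ m * y \<in> J" using xy by blast
      have "t ^ m * (t ^ k * x) + t ^ k * (t ^ m * y) \<in> J" by (intro add mult km)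
      then have "t ^ (k + m) * (x + y) \<in> J" by (simp add: power_add algebra_simps)
      then show ?thesis by blast
    qed
    show "s * x \<in> {x. \<exists>m. t ^ m * x \<in> J}" if x: "x \<in> {x. \<exists>m. t ^ m * x \<in> J}" for s x
    proof -
      obtain m where "t ^ m * x \<in> J" using x by blast
      then have "t ^ m * (s * x) \<in> J" using mult[of "t ^ m * x" s] by (simp add: mult.left_commute)
      then show ?thesis by blast
    qed
  qed
qed

lemma ring_ideal_add_principal:
  assumes "ring_ideal J"
  shows "ring_ideal {x + t * s | x s. x \<in> J}"
proof -
  interpret ring_ideal J by fact
  show ?thesis
  proof
    show "0 \<in> {x + t * s | x s. x \<in> J}"
      using zero by (auto intro!: exI[of _ 0])
    show "x + y \<in> {x + t * s | x s. x \<in> J}"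
      if xy: "x \<in> {x + t * s | x s. x \<in> J}" "y \<in> {x + t * s | x s. x \<in> J}" for x y
    proof -
      obtain x' s y' s' where "x = x' + t * s" "y = y' + t * s'" "x' \<in> J" "y' \<in> J" using xy by blast
      then have "x + y = (x' + y') + t * (s + s')" "x' + y' \<in> J"
        by (simp_all add: algebra_simps add)
      then show ?thesis by blast
    qed
    show "c * x \<in> {x + t * s | x s. x \<in> J}" if x: "x \<in> {x + t * s | x s. x \<in> J}" for c x
    proof -
      obtain x' s where "x = x' + t * s" "x' \<in> J" using x by blast
      then have "c * x = c * x' + t * (c * s)" "c * x' \<in> J"
        by (simp_all add: algebra_simps mult)
      then show ?thesis by blast
    qed
  qed
qed

section \<open>Contraction of ideals along the finite extension\<close>

context finite_over_polynomials
begin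

text \<open>An element of the extended ideal \<open>Y A\<close> is integral over the ideal \<open>(Y)\<close>; all terms of its
  integral equation except the leading one are collected in \<open>Y * s\<close>.\<close>

lemma power_mem_principal:
  assumes J': "ring_ideal J'" "J \<subseteq> J'"
    and p: "poly_eval \<kappa> y p - poly_eval \<kappa> y Y * a \<in> J'"
  shows "\<exists>m s. poly_eval \<kappa> y (p ^ m + Y * s) \<in> J'"
proof -
  interpret J': ring_ideal J' by fact
  let ?ev = "poly_eval \<kappa> y"
  \<comment> \<open>The coefficient vectors of relations among the \<open>b k\<close> modulo
    \<open>J'\<close>.\<close>
  define L where "L = {w. (\<Sum>k<n. ?ev (w k) * b k) \<in> J'}"
  define N where "N = {z. Y dvd z}"
  \<comment> \<open>The elements congruent to a power of \<open>p\<close> modulo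
    \<open>Y\<close>.\<close>
  define U where "U = {p ^ m + z | m z. z \<in> N}"
  interpret N: ring_ideal N unfolding N_def by (rule ring_ideal_principal)
  have "\<exists>c. a * b k - (\<Sum>i<n. ?ev (c i) * b i) \<in> J'" for k
    using spans[of "a * b k"] J'(2) by blast
  then obtain c where c: "\<And>k. a * b k - (\<Sum>i<n. ?ev (c k i) * b i) \<in> J'" by metis
  \<comment> \<open>The matrix \<open>p\<close> times the identity minus \<open>Y\<close> times the
    matrix \<open>c\<close> of multiplication by \<open>a\<close>. Its rows are relations because
    the value of \<open>p\<close> is congruent to that of \<open>Y\<close> times \<open>a\<close>
    modulo \<open>J'\<close>.\<close>
  define P where "P i j = (if i = j then p else 0) + (if j < n then Y * (- c i j) else 0)" for i j
  have "\<exists>Q\<in>U. \<forall>k\<in>{..<n}. (\<lambda>j. if j = k then Q else 0) \<in> L"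
  proof (rule elimination[where N = N and P = P])
    show "(\<lambda>i. w i + w' i) \<in> L" if "w \<in> L" "w' \<in> L" for w w'
      using that J'.add unfolding L_def by (simp add: ev.simps distrib_right sum.distrib)
    show "(\<lambda>i. c * w i) \<in> L" if "w \<in> L" for c w
      using that J'.mult[of "\<Sum>k<n. ?ev (w k) * b k" "?ev c"] unfolding L_def
      by (simp add: ev.simps sum_distrib_left mult.assoc)
    show "1 \<in> U"
      unfolding U_def using N.zero by (auto intro!: exI[of _ 0])
    show "u * v \<in> U" if uv: "u \<in> U" "v \<in> U" for u v
    proof -
      obtain m z m' z' where "u = p ^ m + z" "v = p ^ m' + z'" "z \<in> N" "z' \<in> N"
        using uv unfolding U_def by blast
      then have "u * v = p ^ (m + m') + (p ^ m * z' + z * v)" "p ^ m * z' + z * v \<in> N"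
        by (simp_all add: power_add algebra_simps N.add N.mult N.mult_right)
      then show ?thesis unfolding U_def by blast
    qed
    show "u + z \<in> U" if u: "u \<in> U" and z: "z \<in> N" for u z
    proof -
      obtain m z' where "u = p ^ m + z'" "z' \<in> N" using u unfolding U_def by blast
      then have "u + z = p ^ m + (z' + z)" "z' + z \<in> N"
        using z by (simp_all add: add.assoc N.add)
      then show ?thesis unfolding U_def by blast
    qed
    show "P i \<in> L" if "i \<in> {..<n}" for i
    proof -
      have "(\<Sum>k<n. ?ev (P i k) * b k)
          = (\<Sum>k<n. (if i = k then ?ev p * b k else 0) - ?ev Y * (?ev (c i k) * b k))"
        by (intro sum.cong) (auto simp: P_def ev.simps algebra_simps)
      also have "\<dots> = ?ev p * b i - ?ev Y * (\<Sum>k<n. ?ev (c i k) * b k)"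
        using that by (simp add: sum_subtractf sum_distrib_left)
      also have "\<dots> = b i * (?ev p - ?ev Y * a) + ?ev Y * (a * b i - (\<Sum>k<n. ?ev (c i k) * b k))"
        by (simp add: algebra_simps)
      also have "\<dots> \<in> J'"
        by (intro J'.add J'.mult p c)
      finally show ?thesis by (simp add: L_def)
    qed
    show "P i i \<in> U" if "i \<in> {..<n}" for i
    proof -
      have "P i i = p ^ 1 + Y * (- c i i)" using that by (simp add: P_def)
      then show ?thesis unfolding U_def N_def by (metis (mono_tags, lifting) dvd_triv_left mem_Collect_eq)
    qed
    show "P i j \<in> N" if "j \<noteq> i" for i j
      using that N.zero by (auto simp: P_def N_def)
    show "P i j = 0" if "i \<in> {..<n}" "j \<notin> {..<n}" for i j
      using that by (simp add: P_def)
  qed (simp_all add: N.ring_ideal_axioms)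
  then obtain Q where Q: "Q \<in> U" "\<And>k. k < n \<Longrightarrow> (\<lambda>j. if j = k then Q else 0) \<in> L" by auto
  have Qb: "?ev Q * b k \<in> J'" if "k < n" for k
  proof -
    have "(\<Sum>j<n. ?ev (if j = k then Q else 0) * b j) = (\<Sum>j<n. if j = k then ?ev Q * b k else 0)"
      by (intro sum.cong) (auto simp: ev.zero)
    then show ?thesis using Q(2)[OF that] that by (simp add: L_def)
  qed
  \<comment> \<open>The value of \<open>Q\<close> carries every \<open>b k\<close> into
    \<open>J'\<close>; as 1 is a combination of the \<open>b k\<close> modulo \<open>J'\<close>, the
    value itself lies in \<open>J'\<close>.\<close>
  obtain d where d: "1 - (\<Sum>k<n. ?ev (d k) * b k) \<in> J'"
    using spans[of 1] J'(2) by blast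
  have "?ev Q = ?ev Q * (1 - (\<Sum>k<n. ?ev (d k) * b k)) + (\<Sum>k<n. ?ev (d k) * (?ev Q * b k))"
    by (simp add: right_diff_distrib sum_distrib_left mult_ac)
  also have "\<dots> \<in> J'"
    by (intro J'.add J'.mult J'.sum d Qb) auto
  finally have "?ev Q \<in> J'" .
  with Q(1) show ?thesis unfolding U_def N_def by (auto elim!: dvdE)
qed

text \<open>The kernel of \<open>restrict_vars {k..<r}\<close> on polynomials in \<open>r\<close> variables is the prime ideal generated
  by the first \<open>k\<close> of them.\<close>

lemma krull_term_notin:
  assumes indep: "\<And>p. p \<in> carrier (mpoly_ring r) \<Longrightarrow> poly_eval \<kappa> y p \<in> J \<Longrightarrow> p = 0"
    and y0: "\<And>i. r \<le> i \<Longrightarrow> y i = 0"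
  shows "krull_term y a e [0..<r] \<notin> J"
proof
  assume *: "krull_term y a e [0..<r] \<in> J"
  let ?ev = "poly_eval \<kappa> y"
  have \<kappa>: "comm_ring_hom \<kappa>" by unfold_locales
  \<comment> \<open>Besides containing the inner expression, \<open>J'\<close> has its contraction
    to the polynomials inside the kernel of the restriction to \<open>{k..<r}\<close>.\<close>
  have step: "\<exists>J'. ring_ideal J' \<and> J \<subseteq> J' \<and> krull_term y a e [k..<r] \<in> J' \<and>
      (\<forall>p. ?ev p \<in> J' \<longrightarrow> restrict_vars {k..<r} p = 0)" if "k \<le> r" for k
    using that
  proof (induction k)
    case 0
    have "restrict_vars {0..<r} p = 0" if "?ev p \<in> J" for p
    proof (rule indep)
      show "restrict_vars {0..<r} p \<in> carrier (mpoly_ring r)"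
        using restrict_vars_carrier[of r p] by (simp add: atLeast0LessThan)
      have "?ev (restrict_vars {0..<r} p) = poly_eval \<kappa> (\<lambda>i. ?ev (if i \<in> {0..<r} then mpoly_var i else 0)) p"
        unfolding restrict_vars_def by (rule poly_eval_poly_eval[OF \<kappa>])
      \<comment> \<open>Variables from \<open>r\<close> on have value 0, so discarding them does not
        change the value of \<open>p\<close>.\<close>
      also have "(\<lambda>i. ?ev (if i \<in> {0..<r} then mpoly_var i else 0)) = y"
        using y0 by (auto simp: fun_eq_iff poly_eval_var[OF \<kappa>] ev.zero)
      finally show "?ev (restrict_vars {0..<r} p) \<in> J" using that by simp
    qed
    then show ?case using * J.ring_ideal_axioms by blast
  next
    case (Suc k)
    then obtain J' where J': "ring_ideal J'" "J \<subseteq> J'" "krull_term y a e [k..<r] \<in> J'"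
      "\<And>p. ?ev p \<in> J' \<Longrightarrow> restrict_vars {k..<r} p = 0" by auto
    interpret \<rho>: comm_ring_hom "restrict_vars V :: 'a mpoly \<Rightarrow> 'a mpoly" for V
      by (rule restrict_vars_hom)
    define J1 where "J1 = {x. \<exists>m. y k ^ m * x \<in> J'}"
    define J2 where "J2 = {x + y k * s | x s. x \<in> J1}"
    have J1: "ring_ideal J1" unfolding J1_def by (rule ring_ideal_saturation[OF J'(1)])
    have J2: "ring_ideal J2" unfolding J2_def by (rule ring_ideal_add_principal[OF J1])
    have "J' \<subseteq> J1" unfolding J1_def by (auto intro: exI[of _ 0])
    have "J1 \<subseteq> J2" unfolding J2_def by (force intro: exI[of _ 0])
    \<comment> \<open>Saturating at \<open>y k\<close> keeps the contraction in the kernel: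
      restriction to \<open>{k..<r}\<close> preserves variable \<open>k\<close>, which can then be
      cancelled.\<close>
    have P1: "restrict_vars {k..<r} p = 0" if "?ev p \<in> J1" for p
    proof -
      from that obtain m where "y k ^ m * ?ev p \<in> J'" unfolding J1_def by blast
      then have "?ev (mpoly_var k ^ m * p) \<in> J'"
        by (simp add: ev.simps poly_eval_var[OF \<kappa>])
      then have "restrict_vars {k..<r} (mpoly_var k ^ m * p) = 0" by (rule J'(4))
      then show ?thesis
        using Suc.prems by (simp add: \<rho>.simps restrict_vars_var mpoly_var_nonzero)
    qed
    have "restrict_vars {Suc k..<r} p = 0" if "?ev p \<in> J2" for p
    proof -
      from that obtain x s where "?ev p = x + y k * s" "x \<in> J1" unfolding J2_def by blast
      then have "?ev p - ?ev (mpoly_var k) * s \<in> J1"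
        by (simp add: poly_eval_var[OF \<kappa>])
      then obtain m s where "?ev (p ^ m + mpoly_var k * s) \<in> J1"
        using power_mem_principal[OF J1] \<open>J' \<subseteq> J1\<close> J'(2) by blast
      then have "restrict_vars {k..<r} (p ^ m + mpoly_var k * s) = 0" by (rule P1)
      then have "restrict_vars {Suc k..<r} (restrict_vars {k..<r} (p ^ m + mpoly_var k * s)) = 0"
        by (simp add: \<rho>.zero)
      then have "restrict_vars {Suc k..<r} (p ^ m + mpoly_var k * s) = 0"
        by (simp add: restrict_vars_restrict_vars Int_absorb2)
      \<comment> \<open>Restriction to \<open>{Suc k..<r}\<close> kills variable \<open>k\<close>;
        the remaining power vanishes in a domain, hence so does its base.\<close>
      then have "restrict_vars {Suc k..<r} p ^ m = 0"
        by (simp add: \<rho>.simps restrict_vars_var)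
      then show ?thesis by simp
    qed
    moreover have "krull_term y a e [Suc k..<r] \<in> J2"
    proof -
      have "[k..<r] = k # [Suc k..<r]" using Suc.prems by (simp add: upt_conv_Cons)
      then have "y k ^ e k * (krull_term y a e [Suc k..<r] + a k * y k) \<in> J'"
        using J'(3) by simp
      \<comment> \<open>Saturation strips the outer power of \<open>y k\<close>; the passage to
        \<open>J2\<close> then absorbs \<open>a k * y k\<close>.\<close>
      then have "krull_term y a e [Suc k..<r] + a k * y k \<in> J1" unfolding J1_def by blast
      moreover have "krull_term y a e [Suc k..<r]
          = (krull_term y a e [Suc k..<r] + a k * y k) + y k * (- a k)" by (simp add: mult.commute)
      ultimately show ?thesis unfolding J2_def by blast
    qed
    ultimately show ?case
      using J2 \<open>J1 \<subseteq> J2\<close> \<open>J' \<subseteq> J1\<close> J'(2) by blast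
  qed
  \<comment> \<open>At \<open>k = r\<close> the inner expression is 1, yet restriction to no
    variables fixes 1.\<close>
  from step[of r] obtain J' where "1 \<in> J'" "\<And>p. ?ev p \<in> J' \<Longrightarrow> restrict_vars {r..<r} p = 0"
    by auto
  then have "restrict_vars {r..<r} 1 = (0 :: 'a mpoly)"
    by (simp add: ev.one)
  then show False
    by (simp add: comm_ring_hom.one[OF restrict_vars_hom])
qed

end


section \<open>Quotients of type class rings\<close>

text \<open>Presenting \<open>K[X\<^sub>1, \<dots>, X\<^sub>l] / I\<close> as a quotient of the whole type, with the surplus variables
  mapped to \<open>0\<close>, replaces computations in the carrier by computations in a type class ring.\<close>

locale ring_presentation = A: cring A
  for A :: "('c, 'd) ring_scheme" (structure) and h :: "'b::comm_ring_1 \<Rightarrow> 'c" +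
  assumes h_add: "h (x + y) = h x \<oplus> h y"
    and h_mult: "h (x * y) = h x \<otimes> h y"
    and h_one: "h 1 = \<one>"
    and range_h: "range h = carrier A"
begin

lemma h_closed [simp]: "h x \<in> carrier A"
  using range_h by blast

lemma h_zero: "h 0 = \<zero>"
  using h_add[of 0 0] A.add.l_cancel_one[of "h 0" "h 0"] by simp

lemma h_uminus: "h (- x) = \<ominus> h x"
  using h_add[of "- x" x] A.minus_equality[of "h (- x)" "h x"] by (simp add: h_zero)

lemma h_eq_iff: "h x = h y \<longleftrightarrow> h (x - y) = \<zero>"
  using h_add[of x "- y"] A.r_right_minus_eq[of "h x" "h y"] by (simp add: h_uminus a_minus_def)

lemma h_power: "h (x ^ n) = h x [^] n"
  by (induction n) (simp_all add: h_one h_mult A.m_comm)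

lemma h_sum: "finite S \<Longrightarrow> h (sum f S) = (\<Oplus>i\<in>S. h (f i))"
  by (induction S rule: finite_induct) (simp_all add: h_zero h_add)

lemma h_prod: "finite S \<Longrightarrow> h (prod f S) = (\<Otimes>i\<in>S. h (f i))"
  by (induction S rule: finite_induct) (simp_all add: h_one h_mult)

lemma ring_ideal_kernel: "ring_ideal {x. h x = \<zero>}"
  by unfold_locales (simp_all add: h_zero h_add h_mult)

lemma ex_preimage:
  assumes "\<forall>i<m. x i \<in> carrier A"
  shows "\<exists>x'. \<forall>i<m. x i = h (x' i)"
proof -
  have "\<exists>b. i < m \<longrightarrow> x i = h b" for i
    using assms unfolding range_h[symmetric] by blast
  then show ?thesis by metis
qed

lemma krull_expr_eq:
  assumes "\<forall>i<m. x i = h (x' i)" "\<forall>i<m. a i = h (a' i)"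
  shows "krull_expr A m x a e = h (krull_term x' a' e [0..<m])"
proof -
  have "foldr (\<lambda>i u. (x i [^] e i) \<otimes> (u \<oplus> a i \<otimes> x i)) is \<one> = h (krull_term x' a' e is)"
    if "set is \<subseteq> {..<m}" for "is"
    using that assms by (induction "is") (simp_all add: h_one h_mult h_add h_power)
  then show ?thesis unfolding krull_expr_def by (simp add: atLeast0LessThan)
qed

lemma mpoly_eval_eq:
  assumes "\<And>c. \<phi> c = h (\<kappa> c)" "\<forall>i<r. y i = h (y' i)" "p \<in> carrier (mpoly_ring r)"
  shows "mpoly_eval A \<phi> y p = h (poly_eval \<kappa> y' p)"
proof -
  have "(\<Otimes>i\<in>Poly_Mapping.keys m. y i [^] Poly_Mapping.lookup m i) = h (monom_eval y' m)"
    if "m \<in> Poly_Mapping.keys p" for m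
  proof -
    have "y i = h (y' i)" if "i \<in> Poly_Mapping.keys m" for i
      using that \<open>m \<in> Poly_Mapping.keys p\<close> assms(2,3) unfolding carrier_mpoly_ring_iff by blast
    then show ?thesis
      unfolding monom_eval_def by (auto simp: h_prod h_power intro!: A.finprod_cong')
  qed
  then show ?thesis
    unfolding mpoly_eval_def poly_eval_def
    by (auto simp: h_sum h_mult assms(1) intro!: A.finsum_cong')
qed

text \<open>The values of polynomials contain the generators and are closed under the ring
  operations, so induction along the generation applies.\<close>

lemma generate_ring_preimage:
  assumes "comm_ring_hom \<kappa>" "\<And>c. \<phi> c = h (\<kappa> c)" "\<forall>i<r. y i = h (y' i)"
    and "z \<in> generated_subalgebra A \<phi> r y"
  shows "\<exists>p\<in>carrier (mpoly_ring r). z = h (poly_eval \<kappa> y' p)"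
proof -
  interpret ev: comm_ring_hom "poly_eval \<kappa> y'" by (rule poly_eval_hom) fact
  show ?thesis
    using assms(4) unfolding generated_subalgebra_def
  proof (induction rule: generate_ring.induct)
    case one
    then show ?case by (metis ev.one h_one mpoly_carrier_one)
  next
    case (incl z)
    then consider c where "z = h (\<kappa> c)" | i where "i < r" "z = h (y' i)"
      using assms(2,3) by auto
    then show ?case
      by cases (metis assms(1) poly_eval_const mpoly_carrier_const,
          metis assms(1) poly_eval_var mpoly_carrier_var)
  next
    case (a_inv z)
    then show ?case by (metis ev.uminus h_uminus mpoly_carrier_uminus)
  next
    case (eng_add z z')
    then show ?case by (metis ev.add h_add mpoly_carrier_add)
  next
    case (eng_mult z z')
    then show ?case by (metis ev.mult h_mult mpoly_carrier_mult)
  qed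
qed

text \<open>Coefficients are lifted one by one: an element of the span of a nonempty list is a
  multiple of the head plus an element of the span of the tail.\<close>

lemma span_preimage:
  assumes "\<And>s. s \<in> S \<Longrightarrow> \<exists>p\<in>P. s = h (g p)" and "z \<in> A.Span S (map h bs)"
  shows "\<exists>p. (\<forall>k<length bs. p k \<in> P) \<and> z = h (\<Sum>k<length bs. g (p k) * bs ! k)"
  using assms(2)
proof (induction bs arbitrary: z)
  case Nil
  then show ?case by (simp add: h_zero)
next
  case (Cons b bs)
  then obtain s v where "s \<in> S" "v \<in> A.Span S (map h bs)" "z = s \<otimes> h b \<oplus> v"
    by (auto simp: A.line_extension_mem_iff)
  moreover from this obtain q where "q \<in> P" "s = h (g q)" using assms(1) by blast
  moreover from \<open>v \<in> _\<close> obtain p where "\<forall>k<length bs. p k \<in> P"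
    "v = h (\<Sum>k<length bs. g (p k) * bs ! k)" using Cons.IH by blast
  ultimately show ?case
    \<comment> \<open>The coefficient \<open>q\<close> of the head is put in front and the others
      move up by one index.\<close>
    by (intro exI[of _ "case_nat q p"])
       (simp add: sum.lessThan_Suc_shift h_add h_mult All_less_Suc2 del: sum.lessThan_Suc)
qed

text \<open>With the kernel of \<open>h\<close> as \<open>J\<close>, congruences modulo
  \<open>J\<close> become equations in \<open>A\<close>, and both bounds transfer.\<close>

theorem has_krull_dim:
  assumes \<kappa>: "comm_ring_hom \<kappa>" "\<And>c. \<phi> c = h (\<kappa> c)"
    and y: "\<forall>i<r. y i \<in> carrier A"
    and indep: "algebraically_independent A \<phi> r y"
    and fin: "finitely_generated_over A (generated_subalgebra A \<phi> r y)"
  shows "has_krull_dim A (int r)"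
proof -
  obtain y0 where y0: "\<forall>i<r. y i = h (y0 i)" using ex_preimage[OF y] by blast
  \<comment> \<open>The default 0 from index \<open>r\<close> on is what
    \<open>krull_term_notin\<close> requires.\<close>
  define y' where "y' i = (if i < r then y0 i else 0)" for i
  have y': "\<forall>i<r. y i = h (y' i)" using y0 by (simp add: y'_def)
  define J where "J = {x. h x = \<zero>}"
  obtain cs where cs: "set cs \<subseteq> carrier A" "A.Span (generated_subalgebra A \<phi> r y) cs = carrier A"
    using fin unfolding finitely_generated_over_def by blast
  obtain bs where bs: "cs = map h bs"
    using cs(1) unfolding range_h[symmetric] by (metis ex_map_conv imageE subsetD)
  interpret finite_over_polynomials \<kappa> J r "length bs" y' "\<lambda>k. bs ! k"
  proof (intro finite_over_polynomials.intro finite_over_polynomials_axioms.intro)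
    show "ring_ideal J" unfolding J_def by (rule ring_ideal_kernel)
    show "\<exists>p. (\<forall>k<length bs. p k \<in> carrier (mpoly_ring r)) \<and>
        z - (\<Sum>k<length bs. poly_eval \<kappa> y' (p k) * bs ! k) \<in> J" for z
    proof -
      have "h z \<in> A.Span (generated_subalgebra A \<phi> r y) (map h bs)"
        using cs(2) by (simp add: bs)
      then have "\<exists>p. (\<forall>k<length bs. p k \<in> carrier (mpoly_ring r)) \<and>
          h z = h (\<Sum>k<length bs. poly_eval \<kappa> y' (p k) * bs ! k)"
        by (rule span_preimage[rotated]) (rule generate_ring_preimage[OF \<kappa> y'])
      then show ?thesis by (simp add: J_def h_eq_iff)
    qed
  qed (fact \<kappa>(1))
  have "krull_dim_le A (int r)"
    unfolding krull_dim_le_def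
  proof (intro conjI allI impI)
    fix x assume "\<forall>i<nat (int r + 1). x i \<in> carrier A"
    moreover have Suc: "nat (int r + 1) = Suc r" by simp
    ultimately obtain x' where x': "\<forall>i<Suc r. x i = h (x' i)" using ex_preimage by metis
    obtain a e where "krull_term x' a e [0..<Suc r] \<in> J" using krull_term_mem by blast
    then have "krull_expr A (Suc r) x (\<lambda>i. h (a i)) e = \<zero>"
      unfolding J_def by (subst krull_expr_eq[OF x', of _ a]) auto
    then show "\<exists>a e. (\<forall>i<nat (int r + 1). a i \<in> carrier A) \<and> krull_expr A (nat (int r + 1)) x a e = \<zero>"
      unfolding Suc by (intro exI[of _ "\<lambda>i. h (a i)"] exI[of _ e]) simp
  qed simp
  moreover have "krull_dim_ge A (int r)"
  proof -
    \<comment> \<open>The sequence witnessing the lower bound is \<open>y\<close> itself.\<close>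
    have "krull_expr A r y a e \<noteq> \<zero>" if a: "\<forall>i<r. a i \<in> carrier A" for a e
    proof -
      obtain a' where a': "\<forall>i<r. a i = h (a' i)" using ex_preimage[OF a] by blast
      have "krull_term y' a' e [0..<r] \<notin> J"
      proof (rule krull_term_notin)
        show "p = 0" if "p \<in> carrier (mpoly_ring r)" "poly_eval \<kappa> y' p \<in> J" for p
          using indep that mpoly_eval_eq[OF \<kappa>(2) y' that(1)]
          unfolding algebraically_independent_def J_def by simp
      qed (simp add: y'_def)
      then show ?thesis by (simp add: krull_expr_eq[OF y' a'] J_def)
    qed
    then show ?thesis using y unfolding krull_dim_ge_def by auto
  qed
  ultimately show ?thesis unfolding has_krull_dim_def by blast
qed

end

section \<open>The quotient of the polynomial ring by \<open>I\<close>\<close>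

theorem theorem4p14:
  fixes l r :: nat
    and I S :: "('a::field mpoly) set"
    and y :: "nat \<Rightarrow> 'a mpoly set"
  defines "R \<equiv> (mpoly_ring l :: ('a mpoly) ring)"
  defines "A \<equiv> R Quot I"
  defines "\<phi> \<equiv> (\<lambda>c. I +>\<^bsub>R\<^esub> mpoly_const c)"
  assumes "finite S" and "S \<subseteq> carrier R" and "I = Idl\<^bsub>R\<^esub> S"
    and "\<forall>i<r. y i \<in> carrier A"
    and "algebraically_independent A \<phi> r y"
    and "finitely_generated_over A (generated_subalgebra A \<phi> r y)"
  shows "has_krull_dim A (int r)"
proof -
  interpret R: cring R unfolding R_def by (rule mpoly_ring_cring)
  interpret I: ideal I R using R.genideal_ideal assms(5,6) by simp
  interpret \<pi>: ring_hom_cring R A "(+>\<^bsub>R\<^esub>) I"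
    unfolding A_def by (rule I.rcos_ring_hom_cring) unfold_locales
  interpret \<rho>: comm_ring_hom "restrict_vars {..<l} :: 'a mpoly \<Rightarrow> 'a mpoly"
    by (rule restrict_vars_hom)
  have carrier: "restrict_vars {..<l} p \<in> carrier R" for p :: "'a mpoly"
    unfolding R_def by (rule restrict_vars_carrier)
  have R_ops: "p \<oplus>\<^bsub>R\<^esub> q = p + q" "p \<otimes>\<^bsub>R\<^esub> q = p * q" "\<one>\<^bsub>R\<^esub> = 1" for p q
    by (simp_all add: R_def)
  \<comment> \<open>The presentation first sets the variables from \<open>l\<close> on to 0 and then
    takes the class modulo \<open>I\<close>.\<close>
  interpret ring_presentation A "\<lambda>p. I +>\<^bsub>R\<^esub> restrict_vars {..<l} p"
  proof unfold_locales
    show "I +>\<^bsub>R\<^esub> restrict_vars {..<l} (p + q)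
        = (I +>\<^bsub>R\<^esub> restrict_vars {..<l} p) \<oplus>\<^bsub>A\<^esub> (I +>\<^bsub>R\<^esub> restrict_vars {..<l} q)" for p q :: "'a mpoly"
      using \<pi>.hom_add[OF carrier carrier] by (simp add: \<rho>.add R_ops)
    show "I +>\<^bsub>R\<^esub> restrict_vars {..<l} (p * q)
        = (I +>\<^bsub>R\<^esub> restrict_vars {..<l} p) \<otimes>\<^bsub>A\<^esub> (I +>\<^bsub>R\<^esub> restrict_vars {..<l} q)" for p q :: "'a mpoly"
      using \<pi>.hom_mult[OF carrier carrier] by (simp add: \<rho>.mult R_ops)
    show "I +>\<^bsub>R\<^esub> restrict_vars {..<l} 1 = \<one>\<^bsub>A\<^esub>"
      using \<pi>.hom_one by (simp add: \<rho>.one R_ops)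
    show "range (\<lambda>p. I +>\<^bsub>R\<^esub> restrict_vars {..<l} p) = carrier A"
    proof
      show "range (\<lambda>p. I +>\<^bsub>R\<^esub> restrict_vars {..<l} p) \<subseteq> carrier A"
        using \<pi>.hom_closed[OF carrier] by blast
      show "carrier A \<subseteq> range (\<lambda>p. I +>\<^bsub>R\<^esub> restrict_vars {..<l} p)"
      proof
        fix z assume "z \<in> carrier A"
        then obtain p where "p \<in> carrier R" "z = I +>\<^bsub>R\<^esub> p"
          unfolding A_def FactRing_def A_RCOSETS_def' partial_object.simps by blast
        \<comment> \<open>Truncation fixes polynomials in \<open>l\<close> variables, so every class
          is reached.\<close>
        then have "z = I +>\<^bsub>R\<^esub> restrict_vars {..<l} p"
          by (simp add: R_def restrict_vars_id)
        then show "z \<in> range (\<lambda>p. I +>\<^bsub>R\<^esub> restrict_vars {..<l} p)" by blast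
      qed
    qed
  qed
  show ?thesis
  proof (rule has_krull_dim[OF mpoly_const_hom])
    show "\<phi> c = I +>\<^bsub>R\<^esub> restrict_vars {..<l} (mpoly_const c)" for c
      by (simp add: \<phi>_def restrict_vars_const)
  qed fact+
qed

end
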